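(* Let $T\in\mathbb{P}(S^d\mathbb{C}^3)$ be a form of degree $d$ in three variables, let $A\subset\mathbb{P}^2$ be a non-redundant finite set which computes $T$, and put $r=\ell(A)$. Then $A$ computes the rank of $T$ if one of the following holds: (1) $d=2m$ is even and $h_A(m)=r$ (so that $r\le\binom{m+2}{2}$); (2) $d=2m+1$ is odd, $k_m(A)=\min\{\binom{m+2}{2},r\}$, and $h_A(m+1)=r\le\binom{m+2}{2}+\lceil\frac m2\rceil$.
   Context: Work over $\mathbb{C}$. $S^d\mathbb{C}^{3}$ is the space of forms of degree $d$ in $x_0,x_1,x_2$; a nonzero form $T$ is identified with its class in $\mathbb{P}(S^d\mathbb{C}^3)$. $\mathbb{P}^2$ denotes the projective space of linear forms in $x_0,x_1,x_2$, and $v_d:\mathbb{P}^2\to\mathbb{P}(S^d\mathbb{C}^3)$, $v_d([L])=[L^d]$, is the Veronese map. $\ell(A)$ denotes the cardinality of a finite set $A$, and $\langle\cdot\rangle$ denotes projective linear span. A finite set $A\subset\mathbb{P}^2$ computes $T$ if $T\in\langle v_d(A)\rangle$; it is non-redundant (for $T$) if no proper subset $A'\subsetneq A$ satisfies $T\in\langle v_d(A')\rangle$. The rank of $T$ is $\min\{\ell(A): T\in\langle v_d(A)\rangle\}$. A finite set computes the rank of $T$ if it computes $T$, is non-redundant, and has cardinality equal to the rank of $T$. Hilbert function: choose homogeneous coordinate vectors $Y_1,\dots,Y_\ell\in\mathbb{C}^3$ for the points of $A$ (the point $[a_0x_0+a_1x_1+a_2x_2]$ has coordinates $(a_0,a_1,a_2)$).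 For $j\ge 0$, $h_A(j)$ is the rank of the evaluation map sending a form $F$ of degree $j$ in three variables to $(F(Y_1),\dots,F(Y_\ell))\in\mathbb{C}^{\ell}$; $h_A(j)=0$ for $j<0$. Kruskal rank: $k_j(A)$ is the largest integer $k\le\ell(A)$ such that for every subset $A'\subset A$ with $\ell(A')\le k$ the points $v_j(A')$ are linearly independent, i.e. $\dim\langle v_j(A')\rangle=\ell(A')-1$. *)

theory Defs
  imports
    "HOL-Analysis.Finite_Cartesian_Product"
    "HOL-Library.Poly_Mapping"
    "HOL-Library.Function_Algebras"
begin

section \<open>Ternary forms\<close>

text \<open>
  Polynomials in three variables over the complex numbers, as finitely supported maps from
  exponent vectors to coefficients; the ring operations are those of Poly_Mapping. The index
  type 3 has the elements 0, 1, 2, matching the variables \<open>x\<^sub>0, x\<^sub>1, x\<^sub>2\<close>.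
\<close>

type_synonym ternary = "(3 \<Rightarrow>\<^sub>0 nat) \<Rightarrow>\<^sub>0 complex"

definition scale :: "complex \<Rightarrow> ternary \<Rightarrow> ternary"
  where "scale c F = Poly_Mapping.single 0 c * F"

global_interpretation poly: vector_space scale
  by unfold_locales
    (simp_all add: scale_def distrib_left distrib_right Poly_Mapping.single_add mult_single
      mult.assoc [symmetric])

definition forms :: "nat \<Rightarrow> ternary set"
  where "forms d = {F. \<forall>\<mu> \<in> Poly_Mapping.keys F. (\<Sum>i\<in>UNIV. Poly_Mapping.lookup \<mu> i) = d}"

definition evaluate :: "ternary \<Rightarrow> complex ^ 3 \<Rightarrow> complex"
  where "evaluate F x =
    (\<Sum>\<mu> \<in> Poly_Mapping.keys F.
       Poly_Mapping.lookup F \<mu> * (\<Prod>i\<in>UNIV. (x $ i) ^ Poly_Mapping.lookup \<mu> i))"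

section \<open>Projective spaces of forms\<close>

text \<open>A projective point is represented by the set of all its (nonzero) representatives.\<close>

definition proj_pt :: "ternary \<Rightarrow> ternary set"
  where "proj_pt F = {scale c F | c. c \<noteq> 0}"

definition projectivization :: "ternary set \<Rightarrow> ternary set set"
  where "projectivization V = proj_pt ` (V - {0})"

abbreviation plane :: "ternary set set"
  where "plane \<equiv> projectivization (forms 1)"

definition proj_span :: "ternary set set \<Rightarrow> ternary set set"
  where "proj_span P = projectivization (poly.span (\<Union>P))"

text \<open>Integer-valued, so that the empty projective space has dimension \<open>-1\<close>.\<close>

definition proj_span_dim :: "ternary set set \<Rightarrow> int"
  where "proj_span_dim P = int (poly.dim (\<Union>P)) - 1"

text \<open>
  The class of \<open>L ^ d\<close>, formed from all representatives \<open>L\<close> of the point at once; see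
  \<open>veronese_proj_pt\<close> below.
\<close>

definition veronese :: "nat \<Rightarrow> ternary set \<Rightarrow> ternary set"
  where "veronese d p = {scale c (L ^ d) | c L. c \<noteq> 0 \<and> L \<in> p}"

lemma scale_power: "scale c F ^ d = scale (c ^ d) (F ^ d)"
proof -
  have "Poly_Mapping.single (0 :: 3 \<Rightarrow>\<^sub>0 nat) c ^ d = Poly_Mapping.single 0 (c ^ d)"
    by (induction d) (simp_all add: mult_single)
  then show ?thesis
    by (simp add: scale_def power_mult_distrib)
qed

lemma veronese_proj_pt: "veronese d (proj_pt L) = proj_pt (L ^ d)"
proof
  show "veronese d (proj_pt L) \<subseteq> proj_pt (L ^ d)"
    by (force simp: veronese_def proj_pt_def scale_power)
  show "proj_pt (L ^ d) \<subseteq> veronese d (proj_pt L)"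
  proof
    fix G assume "G \<in> proj_pt (L ^ d)"
    then obtain c where "c \<noteq> 0" "G = scale c (L ^ d)"
      by (auto simp: proj_pt_def)
    moreover have "L \<in> proj_pt L"
      unfolding proj_pt_def by (rule CollectI, rule exI [of _ 1]) simp
    ultimately show "G \<in> veronese d (proj_pt L)"
      unfolding veronese_def by blast
  qed
qed

section \<open>Rank with respect to the Veronese variety\<close>

definition computes :: "nat \<Rightarrow> ternary set set \<Rightarrow> ternary set \<Rightarrow> bool"
  where "computes d A T \<longleftrightarrow>
    finite A \<and> A \<subseteq> plane \<and> T \<in> proj_span (veronese d ` A)"

definition non_redundant :: "nat \<Rightarrow> ternary set set \<Rightarrow> ternary set \<Rightarrow> bool"
  where "non_redundant d A T \<longleftrightarrow> (\<forall>A'. A' \<subset> A \<longrightarrow> T \<notin> proj_span (veronese d ` A'))"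

definition form_rank :: "nat \<Rightarrow> ternary set \<Rightarrow> nat"
  where "form_rank d T = (LEAST r. \<exists>A. computes d A T \<and> card A = r)"

definition computes_rank :: "nat \<Rightarrow> ternary set set \<Rightarrow> ternary set \<Rightarrow> bool"
  where "computes_rank d A T \<longleftrightarrow>
    computes d A T \<and> non_redundant d A T \<and> card A = form_rank d T"

section \<open>Hilbert function and Kruskal ranks of finite sets of points\<close>

text \<open>
  Coordinates of a chosen representative; the Hilbert function below does not depend on the
  choice, since rescaling a representative rescales one coordinate of the evaluation map.
\<close>

definition coords :: "ternary set \<Rightarrow> complex ^ 3"
  where "coords p = (\<chi> i. Poly_Mapping.lookup (SOME L. L \<in> p) (Poly_Mapping.single i 1))"

text \<open>
  The target of the evaluation map is the space of complex-valued functions on \<open>A\<close>, realised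
  as the functions on all points that vanish outside \<open>A\<close>, with pointwise operations.
\<close>

definition eval_map :: "ternary set set \<Rightarrow> ternary \<Rightarrow> ternary set \<Rightarrow> complex"
  where "eval_map A F = (\<lambda>p. if p \<in> A then evaluate F (coords p) else 0)"

definition scale_fun :: "complex \<Rightarrow> ('a \<Rightarrow> complex) \<Rightarrow> 'a \<Rightarrow> complex"
  where "scale_fun c f = (\<lambda>p. c * f p)"

global_interpretation func: vector_space scale_fun
  by unfold_locales (auto simp: scale_fun_def fun_eq_iff algebra_simps)

definition hilbert :: "ternary set set \<Rightarrow> nat \<Rightarrow> nat"
  where "hilbert A j = func.dim (eval_map A ` forms j)"

definition kruskal_rank :: "nat \<Rightarrow> ternary set set \<Rightarrow> nat"
  where "kruskal_rank j A =
    Max {k. k \<le> card A \<and>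
            (\<forall>A' \<subseteq> A. card A' \<le> k \<longrightarrow> proj_span_dim (veronese j ` A') = int (card A') - 1)}"

end

theory Submission
  imports
    Defs
    "HOL-Analysis.Cartesian_Space"
    "HOL-Computational_Algebra.Polynomial_Factorial"
    "HOL-Computational_Algebra.Field_as_Ring"
begin

text \<open>
  Suppose that \<open>B\<close> computes \<open>T\<close> as well. Subtracting the two decompositions and using apolarity
  gives a linear relation with nonzero coefficients between the values of forms of degree \<open>d\<close> at
  a set \<open>Z \<subseteq> A \<union> B\<close>. A relation in degree \<open>i + j\<close> makes the restrictions to \<open>Z\<close> of forms of
  degrees \<open>i\<close> and \<open>j\<close> orthogonal, so that \<open>h\<^sub>Z(i) + h\<^sub>Z(j) \<le> |Z|\<close>; for \<open>d = 2m\<close> and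
  \<open>i = j = m\<close> this is enough.

  For \<open>d = 2m + 1\<close> write \<open>N = (m + 2 choose 2)\<close> and \<open>|A| = N + s\<close>; the case \<open>s \<le> 0\<close> is as before.
  If \<open>|B| < |A|\<close>, then \<open>h\<^sub>Z(m) = N\<close> and \<open>2s \<le> m + 1\<close> leave two independent forms of degree
  \<open>m + 1\<close> vanishing on \<open>Z\<close>. Write them as \<open>C G\<^sub>1\<close> and \<open>C G\<^sub>2\<close> with \<open>G\<^sub>1\<close>, \<open>G\<^sub>2\<close> coprime of
  degree \<open>k\<close>, and let \<open>Y\<close> be the part of \<open>Z\<close> off the curve \<open>C\<close>. By Bezout \<open>|Y| \<le> k\<^sup>2\<close>. On the
  other hand the generality of \<open>A\<close> puts at least \<open>s + k (k + 1) / 2\<close> of its points into \<open>Y\<close> and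
  gives \<open>h\<^sub>Y(k - 1) = k (k + 1) / 2\<close>, while multiplication by \<open>C\<close> turns the relation on \<open>Z\<close> into
  one on \<open>Y\<close> in degree \<open>(k - 1) + (m + 1)\<close>, so \<open>|Y| \<ge> k (k + 1) + s > k\<^sup>2\<close>.
\<close>

section \<open>Substitution into ternary forms\<close>

abbreviation lookup where "lookup \<equiv> Poly_Mapping.lookup"
abbreviation keys where "keys \<equiv> Poly_Mapping.keys"
abbreviation single where "single \<equiv> Poly_Mapping.single"

lemma sum_single_keys: "(\<Sum>\<mu>\<in>keys F. single \<mu> (lookup F \<mu>)) = F"
proof (rule poly_mapping_eqI)
  fix \<nu>
  show "lookup (\<Sum>\<mu>\<in>keys F. single \<mu> (lookup F \<mu>)) \<nu> = lookup F \<nu>"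
    by (cases "\<nu> \<in> keys F")
      (auto simp: lookup_sum lookup_single when_def sum.delta' in_keys_iff)
qed

text \<open>Evaluation at a point, dehomogenization and the regrading of bivariate polynomials by
  total degree are all substitutions along a ring homomorphism of the coefficients, so they share
  one development.\<close>

locale coefficient_hom =
  fixes h :: "'a::comm_ring_1 \<Rightarrow> 'b::comm_ring_1"
  assumes h_0: "h 0 = 0" and h_1: "h 1 = 1"
    and h_add: "h (a + b) = h a + h b" and h_mult: "h (a * b) = h a * h b"
begin

definition subst :: "(3 \<Rightarrow> 'b) \<Rightarrow> ((3 \<Rightarrow>\<^sub>0 nat) \<Rightarrow>\<^sub>0 'a) \<Rightarrow> 'b"
  where "subst v F = (\<Sum>\<mu>\<in>keys F. h (lookup F \<mu>) * (\<Prod>i\<in>UNIV. v i ^ lookup \<mu> i))"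

lemma subst_superset:
  assumes "finite K" "keys F \<subseteq> K"
  shows "subst v F = (\<Sum>\<mu>\<in>K. h (lookup F \<mu>) * (\<Prod>i\<in>UNIV. v i ^ lookup \<mu> i))"
  unfolding subst_def using assms
  by (intro sum.mono_neutral_left) (auto simp: in_keys_iff h_0)

lemma subst_0 [simp]: "subst v 0 = 0"
  by (simp add: subst_def)

lemma subst_add: "subst v (F + G) = subst v F + subst v G"
proof -
  let ?K = "keys F \<union> keys G"
  have "keys (F + G) \<subseteq> ?K" by (rule Poly_Mapping.keys_add)
  then show ?thesis
    by (simp add: subst_superset [of ?K] lookup_add h_add distrib_right sum.distrib)
qed

lemma subst_sum: "subst v (\<Sum>i\<in>I. F i) = (\<Sum>i\<in>I. subst v (F i))"
  by (induction I rule: infinite_finite_induct) (simp_all add: subst_add)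

lemma subst_single: "subst v (single \<mu> c) = h c * (\<Prod>i\<in>UNIV. v i ^ lookup \<mu> i)"
  by (subst subst_superset [of "{\<mu>}"]) auto

lemma subst_mult: "subst v (F * G) = subst v F * subst v G"
proof -
  have single: "subst v (single \<mu> a * single \<nu> b) = subst v (single \<mu> a) * subst v (single \<nu> b)" for \<mu> \<nu> a b
    by (simp add: mult_single subst_single h_mult lookup_add power_add prod.distrib algebra_simps)
  have "F * G = (\<Sum>\<mu>\<in>keys F. \<Sum>\<nu>\<in>keys G. single \<mu> (lookup F \<mu>) * single \<nu> (lookup G \<nu>))"
    by (simp add: sum_single_keys flip: sum_product)
  then have "subst v (F * G) =
      (\<Sum>\<mu>\<in>keys F. subst v (single \<mu> (lookup F \<mu>))) * (\<Sum>\<nu>\<in>keys G. subst v (single \<nu> (lookup G \<nu>)))"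
    by (simp add: subst_sum single sum_product)
  then show ?thesis by (simp add: sum_single_keys flip: subst_sum)
qed

end

interpretation evaluate: coefficient_hom "\<lambda>c :: complex. c"
  by unfold_locales auto

lemma evaluate_eq_subst: "evaluate F a = evaluate.subst (($) a) F"
  by (simp add: evaluate_def evaluate.subst_def)

lemma evaluate_0 [simp]: "evaluate 0 a = 0"
  and evaluate_add: "evaluate (F + G) a = evaluate F a + evaluate G a"
  and evaluate_sum: "evaluate (\<Sum>i\<in>I. f i) a = (\<Sum>i\<in>I. evaluate (f i) a)"
  and evaluate_mult: "evaluate (F * G) a = evaluate F a * evaluate G a"
  and evaluate_scale: "evaluate (scale c F) a = c * evaluate F a"
  and evaluate_single: "evaluate (single \<mu> c) a = c * (\<Prod>i\<in>UNIV. (a $ i) ^ lookup \<mu> i)"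
  by (simp_all add: evaluate_eq_subst evaluate.subst_add evaluate.subst_sum evaluate.subst_mult
      evaluate.subst_single scale_def)

lemma evaluate_diff: "evaluate (F - G) a = evaluate F a - evaluate G a"
  using evaluate_add [of "F - G" G a] by simp

lemma evaluate_1 [simp]: "evaluate 1 a = 1"
  using evaluate_single [of 0 1 a] by simp

lemma evaluate_prod: "evaluate (\<Prod>i\<in>I. f i) a = (\<Prod>i\<in>I. evaluate (f i) a)"
  by (induction I rule: infinite_finite_induct) (simp_all add: evaluate_mult)

lemma evaluate_power: "evaluate (F ^ n) a = evaluate F a ^ n"
  by (induction n) (simp_all add: evaluate_mult)

section \<open>Degrees, monomials and the dimension of the space of forms\<close>

abbreviation weight :: "(3 \<Rightarrow>\<^sub>0 nat) \<Rightarrow> nat"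
  where "weight \<mu> \<equiv> (\<Sum>i\<in>UNIV. lookup \<mu> i)"

lemma weight_add: "weight (\<mu> + \<nu>) = weight \<mu> + weight \<nu>"
  by (simp add: lookup_add sum.distrib)

lemma forms_iff: "F \<in> forms d \<longleftrightarrow> (\<forall>\<mu>. lookup F \<mu> \<noteq> 0 \<longrightarrow> weight \<mu> = d)"
  by (auto simp: forms_def in_keys_iff)

lemma lookup_scale: "lookup (scale c F) \<mu> = c * lookup F \<mu>"
proof -
  have "scale c F = Poly_Mapping.map ((*) c) F"
    by (simp add: scale_def mult_map_scale_conv_mult)
  then show ?thesis by (simp add: Poly_Mapping.map.rep_eq when_def)
qed

lemma subspace_forms: "poly.subspace (forms d)"
proof -
  have "F \<in> forms d \<longleftrightarrow> (\<forall>\<mu>. weight \<mu> \<noteq> d \<longrightarrow> lookup F \<mu> = 0)" for F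
    by (auto simp: forms_iff)
  then show ?thesis by (simp add: poly.subspace_def lookup_add lookup_scale)
qed

lemma forms_mult: "F \<in> forms i \<Longrightarrow> G \<in> forms j \<Longrightarrow> F * G \<in> forms (i + j)"
  using Poly_Mapping.keys_mult [of F G] by (force simp: forms_def weight_add)

lemma single_in_forms: "weight \<mu> = d \<Longrightarrow> single \<mu> c \<in> forms d"
  by (auto simp: forms_def)

lemma one_in_forms: "1 \<in> forms 0"
  by (auto simp: forms_def)

lemma forms_power: "F \<in> forms i \<Longrightarrow> F ^ n \<in> forms (n * i)"
  by (induction n) (auto intro: one_in_forms forms_mult)

lemma forms_prod: "(\<And>i. i \<in> I \<Longrightarrow> F i \<in> forms 1) \<Longrightarrow> finite I \<Longrightarrow> (\<Prod>i\<in>I. F i) \<in> forms (card I)"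
proof (induction I rule: infinite_finite_induct)
  case (insert x I)
  then show ?case using forms_mult [of "F x" 1 "\<Prod>i\<in>I. F i" "card I"] by simp
qed (auto intro: one_in_forms)

lemma scale_mult_right: "F * scale c G = scale c (F * G)"
  by (simp add: scale_def mult_ac)

text \<open>In the index type \<open>3 = 0\<close>, so the last argument is the exponent of
  \<open>x\<^sub>0\<close>, the variable that dehomogenization sets to 1.\<close>

definition exponent :: "nat \<Rightarrow> nat \<Rightarrow> nat \<Rightarrow> (3 \<Rightarrow>\<^sub>0 nat)"
  where "exponent i j k = single 1 i + single 2 j + single 3 k"

lemma lookup_exponent [simp]:
  "lookup (exponent i j k) 1 = i" "lookup (exponent i j k) 2 = j" "lookup (exponent i j k) 3 = k"
  "lookup (exponent i j k) 0 = k"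
  by (simp_all add: exponent_def lookup_add lookup_single when_def)

lemma exponent_eq_iff [simp]: "exponent i j k = exponent i' j' k' \<longleftrightarrow> i = i' \<and> j = j' \<and> k = k'"
  by (metis lookup_exponent(1,2,3))

lemma weight_exponent [simp]: "weight (exponent i j k) = i + j + k"
  by (simp add: sum_3)

lemma exponent_lookup: "exponent (lookup \<mu> 1) (lookup \<mu> 2) (lookup \<mu> 3) = \<mu>"
proof (rule poly_mapping_eqI)
  fix i :: 3
  show "lookup (exponent (lookup \<mu> 1) (lookup \<mu> 2) (lookup \<mu> 3)) i = lookup \<mu> i"
    using exhaust_3 [of i] by auto
qed

lemma exponents_of_weight:
  "{\<mu>. weight \<mu> = t} = (\<lambda>(i, j). exponent i j (t - i - j)) ` (SIGMA i:{..t}. {..t - i})"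
proof safe
  fix \<mu> :: "3 \<Rightarrow>\<^sub>0 nat" assume "t = weight \<mu>"
  then show "\<mu> \<in> (\<lambda>(i, j). exponent i j (weight \<mu> - i - j)) ` (SIGMA i:{..weight \<mu>}. {..weight \<mu> - i})"
    by (intro image_eqI [of _ _ "(lookup \<mu> 1, lookup \<mu> 2)"])
      (simp_all add: sum_3 exponent_lookup)
qed auto

lemma finite_exponents_of_weight: "finite {\<mu>. weight \<mu> = t}"
  by (simp add: exponents_of_weight)

lemma card_exponents_of_weight: "card {\<mu>. weight \<mu> = t} = (t + 2) choose 2"
proof -
  have "inj_on (\<lambda>(i, j). exponent i j (t - i - j)) (SIGMA i:{..t}. {..t - i})"
    by (auto intro!: inj_onI)
  then have "card {\<mu>. weight \<mu> = t} = (\<Sum>i\<le>t. t - i + 1)"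
    by (simp add: exponents_of_weight card_image)
  also have "\<dots> = (\<Sum>i\<le>t. i + 1)"
    by (rule sum.reindex_bij_witness [of _ "\<lambda>i. t - i" "\<lambda>i. t - i"]) auto
  also have "\<dots> = (t + 2) choose 2"
    by (induction t) (auto simp: numeral_2_eq_2)
  finally show ?thesis .
qed

lemma monomial_basis:
  "poly.independent ((\<lambda>\<mu>. single \<mu> (1::complex)) ` {\<mu>. weight \<mu> = t})"
  "forms t \<subseteq> poly.span ((\<lambda>\<mu>. single \<mu> (1::complex)) ` {\<mu>. weight \<mu> = t})"
  "inj_on (\<lambda>\<mu>. single \<mu> (1::complex)) {\<mu>. weight \<mu> = t}"
proof -
  let ?W = "{\<mu>. weight \<mu> = t}"
  show inj: "inj_on (\<lambda>\<mu>. single \<mu> (1::complex)) ?W"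
    by (rule inj_onI) (metis keys_single singleton_inject zero_neq_one)
  show "poly.independent ((\<lambda>\<mu>. single \<mu> (1::complex)) ` ?W)"
  proof (rule poly.independent_if_scalars_zero)
    fix f x assume "(\<Sum>x\<in>(\<lambda>\<mu>. single \<mu> (1::complex)) ` ?W. scale (f x) x) = 0" "x \<in> (\<lambda>\<mu>. single \<mu> (1::complex)) ` ?W"
    then obtain \<nu> where \<nu>: "x = single \<nu> 1" "weight \<nu> = t"
      and *: "(\<Sum>\<mu>\<in>?W. scale (f (single \<mu> 1)) (single \<mu> 1)) = 0"
      by (auto simp: sum.reindex [OF inj])
    have "lookup (\<Sum>\<mu>\<in>?W. scale (f (single \<mu> 1)) (single \<mu> 1)) \<nu> = f x"
      using \<nu> finite_exponents_of_weight [of t]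
      by (simp add: lookup_sum lookup_scale lookup_single when_def if_distrib [of "(*) _"] cong: if_cong)
    then show "f x = 0" by (simp add: *)
  qed (simp add: finite_exponents_of_weight)
  show "forms t \<subseteq> poly.span ((\<lambda>\<mu>. single \<mu> (1::complex)) ` ?W)"
  proof
    fix F assume F: "F \<in> forms t"
    have "F = (\<Sum>\<mu>\<in>keys F. scale (lookup F \<mu>) (single \<mu> 1))"
      using sum_single_keys [of F] by (simp add: scale_def mult_single)
    also have "\<dots> \<in> poly.span ((\<lambda>\<mu>. single \<mu> (1::complex)) ` ?W)"
      using F by (intro poly.span_sum poly.span_scale poly.span_base) (auto simp: forms_def)
    finally show "F \<in> poly.span ((\<lambda>\<mu>. single \<mu> (1::complex)) ` ?W)" .
  qed
qed

lemma dim_forms: "poly.dim (forms t) = (t + 2) choose 2"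
proof -
  have "poly.dim (forms t) = card ((\<lambda>\<mu>. single \<mu> (1::complex)) ` {\<mu>. weight \<mu> = t})"
    using monomial_basis [of t] by (intro poly.dim_unique) (auto intro: single_in_forms)
  then show ?thesis
    using monomial_basis(3) [of t] card_exponents_of_weight by (simp add: card_image)
qed

section \<open>Forms vanishing on points\<close>

text \<open>The space of all polynomials is infinite-dimensional, and \<open>dim\<close> takes the
  value 0 on a subspace with an infinite basis. This lemma and the next three therefore carry a
  finite set \<open>B\<close> whose span contains the spaces involved.\<close>

lemma (in vector_space) dim_mono_finite:
  assumes "U \<subseteq> span W" "W \<subseteq> span B" "finite B"
  shows "dim U \<le> dim W"
proof -
  obtain C where C: "C \<subseteq> W" "independent C" "W \<subseteq> span C" "card C = dim W"
    using basis_exists by blast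
  have "C \<subseteq> span B" using C(1) assms(2) by blast
  then have "finite C"
    using independent_span_bound [OF assms(3) C(2)] by blast
  moreover have "U \<subseteq> span C"
    using assms(1) span_minimal [OF C(3)] by auto
  ultimately show ?thesis
    using dim_le_card C(4) by metis
qed

lemma (in vector_space) finite_basis_exists:
  assumes "U \<subseteq> span B" "finite B" "subspace U"
  obtains C where "finite C" "C \<subseteq> U" "independent C" "span C = U" "card C = dim U"
proof -
  obtain C where C: "C \<subseteq> U" "independent C" "U \<subseteq> span C" "card C = dim U"
    using basis_exists by blast
  moreover have "C \<subseteq> span B" using C(1) assms(1) by blast
  then have "finite C" using independent_span_bound [OF assms(2) C(2)] by blast
  moreover have "span C = U" using C assms(3) span_minimal by blast
  ultimately show ?thesis using that by blast
qed

text \<open>\<open>K\<close> is cut out of \<open>U\<close> by one linear condition that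
  \<open>x\<close> violates, so its codimension is one. The condition will be vanishing at one more
  point.\<close>

lemma (in vector_space) dim_insert_one:
  assumes U: "U \<subseteq> span B" "finite B" "subspace U"
    and K: "K \<subseteq> U" "subspace K" and x: "x \<in> U" "x \<notin> K"
    and decomp: "\<And>u. u \<in> U \<Longrightarrow> \<exists>c. u - scale c x \<in> K"
  shows "dim U = dim K + 1"
proof -
  obtain C where C: "finite C" "C \<subseteq> K" "independent C" "span C = K" "card C = dim K"
    using finite_basis_exists [of K B] assms by blast
  have "independent (insert x C)"
    using C x by (intro independent_insertI) auto
  moreover have "U \<subseteq> span (insert x C)"
    using decomp by (auto simp: span_insert C(4))
  ultimately have "dim U = card (insert x C)"
    using C x K by (intro dim_unique) auto
  moreover have "x \<notin> C" using C x by blast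
  ultimately show ?thesis using C by simp
qed

text \<open>Grassmann's formula: a basis \<open>C\<close> of the intersection extends to bases
  \<open>CU\<close> and \<open>CW\<close> of the two subspaces, and
  \<open>CU \<union> (CW - C)\<close> is a basis of the sum.\<close>

lemma (in vector_space) dim_sum_Int:
  assumes U: "U \<subseteq> span B" "finite B" "subspace U" and W: "W \<subseteq> span B" "subspace W"
  shows "dim {u + w | u w. u \<in> U \<and> w \<in> W} + dim (U \<inter> W) = dim U + dim W"
proof -
  let ?S = "{u + w | u w. u \<in> U \<and> w \<in> W}"
  have "U \<inter> W \<subseteq> span B" using U by blast
  with U W obtain C where C: "finite C" "C \<subseteq> U \<inter> W" "independent C" "span C = U \<inter> W" "card C = dim (U \<inter> W)"
    using finite_basis_exists [of "U \<inter> W" B] subspace_inter by metis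
  obtain CU where CU: "C \<subseteq> CU" "CU \<subseteq> U" "independent CU" "U \<subseteq> span CU"
    using maximal_independent_subset_extend [of C U] C by blast
  obtain CW where CW: "C \<subseteq> CW" "CW \<subseteq> W" "independent CW" "W \<subseteq> span CW"
    using maximal_independent_subset_extend [of C W] C by blast
  have "CU \<subseteq> span B" "CW \<subseteq> span B" using CU CW U W by auto
  then have fin: "finite CU" "finite CW"
    using independent_span_bound U(2) CU CW by blast+
  have spU: "span CU = U" and spW: "span CW = W"
    using CU CW U W span_minimal by blast+
  \<comment> \<open>The vectors of \<open>CW - C\<close> join \<open>CU\<close> one at a time. If
    \<open>x = u + w\<close> with \<open>u\<close> in \<open>U\<close> and \<open>w\<close> in the
    span of \<open>D\<close>, then \<open>u = x - w\<close> lies in \<open>U \<inter> W\<close>, the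
    span of \<open>C\<close>, which makes \<open>CW\<close> dependent.\<close>
  have ind: "independent (CU \<union> D) \<and> CU \<inter> D = {}" if "D \<subseteq> CW - C" "finite D" for D
    using that(2,1)
  proof (induction D rule: finite_induct)
    case empty
    then show ?case using CU by simp
  next
    case (insert x D)
    have x: "x \<in> W" "x \<in> CW" "x \<notin> C" using insert CW by auto
    have "x \<notin> span (CU \<union> D)"
    proof
      assume "x \<in> span (CU \<union> D)"
      then obtain u w where uw: "x = u + w" "u \<in> U" "w \<in> span D"
        by (auto simp: span_Un spU)
      have "w \<in> W" using uw(3) insert.prems CW(2) spW span_mono [of D CW] by blast
      then have "u \<in> U \<inter> W"
        using uw x subspace_diff [OF W(2), of x w] by simp
      then have "x \<in> span (C \<union> D)"
        using uw by (auto simp: span_Un C)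
      moreover have "C \<union> D \<subseteq> CW - {x}" using insert x CW by auto
      ultimately have "x \<in> span (CW - {x})" using span_mono by blast
      then show False using CW(3) x(2) dependent_def by blast
    qed
    moreover have "x \<notin> CU" using calculation span_base by blast
    ultimately show ?case
      using insert independent_insertI [of x "CU \<union> D"] by simp
  qed
  have D: "independent (CU \<union> (CW - C))" "CU \<inter> (CW - C) = {}"
    using ind [of "CW - C"] fin by auto
  have "CU \<union> (CW - C) \<subseteq> ?S"
  proof -
    have "u + 0 \<in> ?S" if "u \<in> U" for u using that subspace_0 [OF W(2)] by blast
    moreover have "0 + w \<in> ?S" if "w \<in> W" for w using that subspace_0 [OF U(3)] by blast
    ultimately show ?thesis using CU CW by auto
  qed
  moreover have "?S \<subseteq> span (CU \<union> (CW - C))"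
  proof -
    have "span (CU \<union> (CW - C)) = span (CU \<union> CW)" using CU by (intro arg_cong [of _ _ span]) blast
    then show ?thesis by (auto simp: span_Un spU spW)
  qed
  ultimately have "dim ?S = card (CU \<union> (CW - C))"
    using D by (intro dim_unique) auto
  also have "\<dots> = card CU + (card CW - card C)"
    using D fin CW(1) C(1) by (simp add: card_Un_disjoint card_Diff_subset)
  finally have "dim ?S = card CU + (card CW - card C)" .
  moreover have "card CU = dim U" "card CW = dim W"
    using CU CW basis_card_eq_dim by auto
  moreover have "card C \<le> card CW" using CW fin by (simp add: card_mono)
  ultimately show ?thesis using C by simp
qed

section \<open>Interpolation and the Hilbert function of a finite set of points\<close>

definition vanishing :: "nat \<Rightarrow> (complex ^ 3) set \<Rightarrow> ternary set"
  where "vanishing t Z = {F \<in> forms t. \<forall>p\<in>Z. evaluate F p = 0}"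

text \<open>For finite \<open>J\<close>: the points impose independent conditions on forms of degree
  \<open>t\<close>. Independence is expressed by a dual family of Lagrange forms because these serve
  as test forms later.\<close>

definition interpolating :: "nat \<Rightarrow> (complex ^ 3) set \<Rightarrow> bool"
  where "interpolating t J \<longleftrightarrow>
    (\<forall>p\<in>J. \<exists>F\<in>forms t. evaluate F p = 1 \<and> (\<forall>q\<in>J - {p}. evaluate F q = 0))"

text \<open>By rank-nullity this codimension is the rank of the evaluation map at the points of
  \<open>Z\<close>. The subtraction never truncates.\<close>

definition hilbert_fun :: "nat \<Rightarrow> (complex ^ 3) set \<Rightarrow> nat"
  where "hilbert_fun t Z = poly.dim (forms t) - poly.dim (vanishing t Z)"

lemma subspace_vanishing: "poly.subspace (vanishing t Z)"
  using subspace_forms [of t]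
  by (auto simp: vanishing_def poly.subspace_def evaluate_add evaluate_scale)

lemma forms_finite_span: obtains B where "finite B" "forms t \<subseteq> poly.span B"
  using monomial_basis(2) [of t] finite_exponents_of_weight [of t] by (metis finite_imageI)

lemma vanishing_subset_forms: "vanishing t Z \<subseteq> forms t"
  by (auto simp: vanishing_def)

lemma vanishing_antimono: "Y \<subseteq> Z \<Longrightarrow> vanishing t Z \<subseteq> vanishing t Y"
  by (auto simp: vanishing_def)

lemma dim_mono_forms:
  assumes "U \<subseteq> V" "V \<subseteq> forms t"
  shows "poly.dim U \<le> poly.dim V"
proof -
  obtain B where "finite B" "forms t \<subseteq> poly.span B" using forms_finite_span .
  then show ?thesis
    using assms poly.span_superset [of V] by (intro poly.dim_mono_finite [of U V B]) auto
qed

lemma hilbert_fun_add_dim: "hilbert_fun t Z + poly.dim (vanishing t Z) = (t + 2) choose 2"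
  using dim_mono_forms [of "vanishing t Z" "forms t" t]
  by (simp add: hilbert_fun_def vanishing_subset_forms dim_forms)

lemma hilbert_fun_mono: "Y \<subseteq> Z \<Longrightarrow> hilbert_fun t Y \<le> hilbert_fun t Z"
  using dim_mono_forms [OF vanishing_antimono [of Y Z t] vanishing_subset_forms]
  by (simp add: hilbert_fun_def)

lemma interpolating_subset: "interpolating t J \<Longrightarrow> K \<subseteq> J \<Longrightarrow> interpolating t K"
  unfolding interpolating_def by blast

lemma interpolating_insert:
  assumes J: "interpolating t J" "p \<notin> J" and F: "F \<in> vanishing t J" "evaluate F p \<noteq> 0"
  shows "interpolating t (insert p J)"
  unfolding interpolating_def
proof
  fix q assume q: "q \<in> insert p J"
  show "\<exists>G\<in>forms t. evaluate G q = 1 \<and> (\<forall>x\<in>insert p J - {q}. evaluate G x = 0)"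
  proof (cases "q = p")
    case True
    then show ?thesis using F J(2) subspace_forms [of t]
      by (intro bexI [of _ "scale (1 / evaluate F p) F"])
        (auto simp: vanishing_def evaluate_scale poly.subspace_scale)
  next
    case False
    then obtain G where G: "G \<in> forms t" "evaluate G q = 1" "\<forall>x\<in>J - {q}. evaluate G x = 0"
      using J(1) q unfolding interpolating_def by blast
    \<comment> \<open>The multiple of \<open>F\<close> cancels the value of \<open>G\<close> at
      \<open>p\<close> and changes nothing on \<open>J\<close>, where \<open>F\<close>
      vanishes.\<close>
    let ?G = "G - scale (evaluate G p / evaluate F p) F"
    have "?G \<in> forms t"
      using G F subspace_forms [of t]
      by (auto simp: vanishing_def intro!: poly.subspace_diff poly.subspace_scale)
    moreover have "evaluate ?G q = 1" "\<forall>x\<in>insert p J - {q}. evaluate ?G x = 0"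
      using F G False q J(2) by (auto simp: vanishing_def evaluate_diff evaluate_scale)
    ultimately show ?thesis by blast
  qed
qed

text \<open>Each new point lowers the dimension of the vanishing forms by exactly one, since its
  Lagrange form vanishes at the earlier points but not at the new one.\<close>

lemma interpolating_hilbert_fun:
  assumes "finite J" "interpolating t J"
  shows "hilbert_fun t J = card J"
proof -
  have "poly.dim (vanishing t J) + card J = (t + 2) choose 2"
    using assms
  proof (induction J rule: finite_induct)
    case empty
    then show ?case by (simp add: vanishing_def dim_forms)
  next
    case (insert p J)
    obtain E where E: "E \<in> forms t" "evaluate E p = 1" "\<forall>q\<in>insert p J - {p}. evaluate E q = 0"
      using insert.prems unfolding interpolating_def by blast
    obtain B where B: "finite B" "forms t \<subseteq> poly.span B"
      using forms_finite_span by blast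
    have "poly.dim (vanishing t J) = poly.dim (vanishing t (insert p J)) + 1"
    proof (rule poly.dim_insert_one [of _ B _ E])
      show "vanishing t J \<subseteq> poly.span B" using B vanishing_subset_forms by blast
      show "E \<in> vanishing t J" using E insert.hyps by (auto simp: vanishing_def)
      show "E \<notin> vanishing t (insert p J)" using E by (auto simp: vanishing_def)
      fix F assume F: "F \<in> vanishing t J"
      have "F - scale (evaluate F p) E \<in> vanishing t (insert p J)"
        using E F insert.hyps subspace_forms [of t]
        by (auto simp: vanishing_def evaluate_diff evaluate_scale
            intro!: poly.subspace_diff poly.subspace_scale)
      then show "\<exists>c. F - scale c E \<in> vanishing t (insert p J)" by blast
    qed (auto simp: B subspace_vanishing vanishing_antimono subset_insertI)
    moreover have "interpolating t J" using insert.prems interpolating_subset by blast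
    ultimately show ?case using insert by simp
  qed
  then show ?thesis using hilbert_fun_add_dim [of t J] by linarith
qed

text \<open>Greedy choice: a point is kept exactly when some form vanishing at the points kept so
  far is nonzero there.\<close>

lemma maximal_interpolating:
  assumes "finite Z"
  obtains J where "J \<subseteq> Z" "interpolating t J" "vanishing t J = vanishing t Z"
proof -
  have "\<exists>J\<subseteq>Z. interpolating t J \<and> vanishing t J = vanishing t Z"
    using assms
  proof (induction Z rule: finite_induct)
    case empty
    then show ?case by (auto simp: interpolating_def)
  next
    case (insert p Z)
    then obtain J where J: "J \<subseteq> Z" "interpolating t J" "vanishing t J = vanishing t Z" by blast
    show ?case
    proof (cases "\<forall>F\<in>vanishing t J. evaluate F p = 0")
      case True
      then have "vanishing t J = vanishing t (insert p Z)"
        using J by (auto simp: vanishing_def)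
      then show ?thesis using J by blast
    next
      case False
      then have "interpolating t (insert p J)"
        using J insert by (blast intro: interpolating_insert)
      moreover have "vanishing t (insert p J) = vanishing t (insert p Z)"
        using J(3) by (auto simp: vanishing_def)
      ultimately show ?thesis using J(1) by (meson insert_mono)
    qed
  qed
  then show ?thesis using that by blast
qed

lemma hilbert_fun_eq_card_interpolating:
  assumes "finite Z"
  obtains J where "J \<subseteq> Z" "interpolating t J" "vanishing t J = vanishing t Z" "hilbert_fun t Z = card J"
proof -
  obtain J where J: "J \<subseteq> Z" "interpolating t J" "vanishing t J = vanishing t Z"
    using maximal_interpolating assms by blast
  moreover have "hilbert_fun t Z = card J"
    using interpolating_hilbert_fun [of J t] J assms
    by (simp add: hilbert_fun_def finite_subset)
  ultimately show ?thesis using that by blast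
qed

lemma hilbert_fun_le_card: "finite Z \<Longrightarrow> hilbert_fun t Z \<le> card Z"
  by (rule hilbert_fun_eq_card_interpolating [of Z t]) (auto intro: card_mono)

text \<open>
  Testing the relation against products with the interpolating forms of a maximal \<open>J \<subseteq> Z\<close> in
  degree \<open>i\<close> shows that a form of degree \<open>j\<close> vanishing on \<open>Z - J\<close> vanishes on all of \<open>Z\<close>.
\<close>

lemma relation_hilbert_fun:
  assumes "finite Z" and \<tau>: "\<And>p. p \<in> Z \<Longrightarrow> \<tau> p \<noteq> 0"
    and rel: "\<And>F. F \<in> forms (i + j) \<Longrightarrow> (\<Sum>p\<in>Z. \<tau> p * evaluate F p) = 0"
  shows "hilbert_fun i Z + hilbert_fun j Z \<le> card Z"
proof -
  obtain J where J: "J \<subseteq> Z" "interpolating i J" "hilbert_fun i Z = card J"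
    using hilbert_fun_eq_card_interpolating assms(1) by metis
  have "vanishing j (Z - J) \<subseteq> vanishing j Z"
  proof
    fix G assume G: "G \<in> vanishing j (Z - J)"
    have "evaluate G p = 0" if p: "p \<in> J" for p
    proof -
      obtain E where E: "E \<in> forms i" "evaluate E p = 1" "\<forall>q\<in>J - {p}. evaluate E q = 0"
        using J(2) p unfolding interpolating_def by blast
      have "(\<Sum>q\<in>Z. \<tau> q * evaluate (E * G) q) = (\<Sum>q\<in>{p}. \<tau> q * evaluate (E * G) q)"
        using assms(1) J(1) p E G
        by (intro sum.mono_neutral_right) (auto simp: evaluate_mult vanishing_def)
      moreover have "E * G \<in> forms (i + j)"
        using E G by (auto simp: vanishing_def intro: forms_mult)
      ultimately have "\<tau> p * evaluate G p = 0"
        using rel [of "E * G"] E by (simp add: evaluate_mult)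
      then show ?thesis using \<tau> p J(1) by auto
    qed
    then show "G \<in> vanishing j Z" using G by (auto simp: vanishing_def)
  qed
  \<comment> \<open>So \<open>Z - J\<close> has the same Hilbert function in degree \<open>j\<close>
    as \<open>Z\<close>, with only \<open>card Z - card J\<close> points to account for it.\<close>
  then have "vanishing j (Z - J) = vanishing j Z"
    using vanishing_antimono [of "Z - J" Z j] by blast
  then have "hilbert_fun j Z = hilbert_fun j (Z - J)"
    by (simp add: hilbert_fun_def)
  also have "\<dots> \<le> card Z - card J"
    using hilbert_fun_le_card [of "Z - J" j] J assms(1)
    by (simp add: card_Diff_subset finite_subset)
  finally show ?thesis
    using J assms(1) card_mono [of Z J] by linarith
qed

section \<open>Greatest common divisors of forms\<close>

context coefficient_hom
begin

definition poly_subst :: "'b \<Rightarrow> 'a poly \<Rightarrow> 'b"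
  where "poly_subst v p = poly (map_poly h p) v"

lemma poly_subst_0 [simp]: "poly_subst v 0 = 0"
  by (simp add: poly_subst_def)

lemma poly_subst_pCons: "poly_subst v (pCons a p) = h a + v * poly_subst v p"
  by (simp add: poly_subst_def map_poly_pCons h_0)

lemma poly_subst_1: "poly_subst v 1 = 1"
  by (simp add: one_pCons poly_subst_pCons h_1)

lemma poly_subst_add: "poly_subst v (p + q) = poly_subst v p + poly_subst v q"
  by (induction p q rule: poly_induct2) (simp_all add: poly_subst_pCons h_add algebra_simps)

lemma poly_subst_smult: "poly_subst v (smult a p) = h a * poly_subst v p"
  by (induction p) (simp_all add: poly_subst_pCons h_mult algebra_simps)

lemma poly_subst_mult: "poly_subst v (p * q) = poly_subst v p * poly_subst v q"
  by (induction p) (simp_all add: poly_subst_pCons poly_subst_add poly_subst_smult h_0 algebra_simps)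

end

text \<open>
  The substitution \<open>x \<mapsto> T\<close>, \<open>y \<mapsto> u T\<close> on \<open>\<complex>[x][y]\<close>, with values in \<open>\<complex>[u][T]\<close>,
  turns the total degree into the degree in the outer variable, where it is additive.
\<close>

interpretation scalar: coefficient_hom "\<lambda>c :: complex. [:[:c:]:]"
  by unfold_locales (auto simp: one_pCons)

interpretation inner: coefficient_hom "scalar.poly_subst [:0, 1:]"
  by unfold_locales (simp_all add: scalar.poly_subst_1 scalar.poly_subst_add scalar.poly_subst_mult)

abbreviation grade :: "complex poly poly \<Rightarrow> complex poly poly"
  where "grade \<equiv> inner.poly_subst [:0, [:0, 1:]:]"

lemma coeff_inner: "coeff (scalar.poly_subst [:0, 1:] q) s = [:coeff q s:]"
proof (induction q arbitrary: s)
  case (pCons a q)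
  then show ?case by (cases s) (simp_all add: scalar.poly_subst_pCons)
qed simp

text \<open>The monomial \<open>x^i y^j\<close> becomes \<open>u^j T^(i + j)\<close>; distinct
  monomials stay distinct, so no coefficients merge.\<close>

lemma coeff_grade: "coeff (coeff (grade f) s) j = (if j \<le> s then coeff (coeff f j) (s - j) else 0)"
proof (induction f arbitrary: s j)
  case (pCons q f)
  then show ?case
    by (cases s; cases j) (simp_all add: inner.poly_subst_pCons coeff_inner coeff_pCons split: nat.split)
qed simp

definition total_degree :: "complex poly poly \<Rightarrow> nat"
  where "total_degree f = degree (grade f)"

lemma total_degree_le_iff:
  "total_degree f \<le> t \<longleftrightarrow> (\<forall>i j. coeff (coeff f j) i \<noteq> 0 \<longrightarrow> i + j \<le> t)"
proof
  assume t: "total_degree f \<le> t"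
  show "\<forall>i j. coeff (coeff f j) i \<noteq> 0 \<longrightarrow> i + j \<le> t"
  proof (intro allI impI)
    fix i j assume "coeff (coeff f j) i \<noteq> 0"
    then have "coeff (coeff (grade f) (i + j)) j \<noteq> 0" by (simp add: coeff_grade)
    then have "coeff (grade f) (i + j) \<noteq> 0" by auto
    then show "i + j \<le> t" using t le_degree order_trans unfolding total_degree_def by blast
  qed
next
  assume *: "\<forall>i j. coeff (coeff f j) i \<noteq> 0 \<longrightarrow> i + j \<le> t"
  show "total_degree f \<le> t"
    unfolding total_degree_def
  proof (intro degree_le allI impI poly_eqI)
    fix s j assume "t < s"
    then show "coeff (coeff (grade f) s) j = coeff 0 j"
      using * [rule_format, of j "s - j"] by (force simp: coeff_grade)
  qed
qed

lemma grade_eq_0_iff [simp]: "grade f = 0 \<longleftrightarrow> f = 0"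
proof
  assume "grade f = 0"
  then have "coeff (coeff f j) i = 0" for i j
    using coeff_grade [of f "i + j" j] by simp
  then show "f = 0" by (simp add: poly_eq_iff)
qed simp

lemma total_degree_mult:
  "f \<noteq> 0 \<Longrightarrow> g \<noteq> 0 \<Longrightarrow> total_degree (f * g) = total_degree f + total_degree g"
  by (simp add: total_degree_def inner.poly_subst_mult degree_mult_eq)

text \<open>The variables \<open>x\<^sub>1\<close> and \<open>x\<^sub>2\<close> become the inner and
  the outer variable; the last case is index \<open>3 = 0\<close>, so \<open>x\<^sub>0\<close>
  becomes 1.\<close>

definition dehomogenize :: "ternary \<Rightarrow> complex poly poly"
  where "dehomogenize = scalar.subst (\<lambda>i. if i = 1 then [:[:0, 1:]:] else if i = 2 then [:0, 1:] else 1)"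

lemma dehomogenize_mult: "dehomogenize (F * G) = dehomogenize F * dehomogenize G"
  by (simp add: dehomogenize_def scalar.subst_mult)

lemma dehomogenize_0 [simp]: "dehomogenize 0 = 0"
  by (simp add: dehomogenize_def)

lemma dehomogenize_sum: "dehomogenize (\<Sum>i\<in>I. F i) = (\<Sum>i\<in>I. dehomogenize (F i))"
  by (simp add: dehomogenize_def scalar.subst_sum)

lemma dehomogenize_single:
  "dehomogenize (single \<mu> c) = monom (monom c (lookup \<mu> 1)) (lookup \<mu> 2)"
proof -
  have x: "[:[:0, 1::complex:]:] ^ i = [:monom 1 i:]" for i
    by (induction i) (simp_all add: monom_Suc monom_0 pCons_one)
  have y: "[:0, 1::complex poly:] ^ j = monom 1 j" for j
    by (simp only: monom_altdef smult_1_left)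
  have prod3: "(\<Prod>i\<in>UNIV. f i) = f 1 * f 2 * f 3" for f :: "3 \<Rightarrow> complex poly poly"
    unfolding UNIV_3
    by (subst prod.insert, simp, simp, subst prod.insert, simp, simp, simp add: mult.assoc)
  have v: "(if (1::3) = 1 then a else if (1::3) = 2 then b else c) = a"
    "(if (2::3) = 1 then a else if (2::3) = 2 then b else c) = b"
    "(if (3::3) = 1 then a else if (3::3) = 2 then b else c) = c" for a b c :: "complex poly poly"
    by simp_all
  show ?thesis
    unfolding dehomogenize_def scalar.subst_single prod3 v x y power_one mult_1_right
    by (simp add: smult_monom mult_monom flip: monom_0)
qed

lemma coeff_dehomogenize:
  assumes "F \<in> forms t"
  shows "coeff (coeff (dehomogenize F) j) i = (if i + j \<le> t then lookup F (exponent i j (t - i - j)) else 0)"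
proof -
  have "dehomogenize F = (\<Sum>\<mu>\<in>keys F. monom (monom (lookup F \<mu>) (lookup \<mu> 1)) (lookup \<mu> 2))"
    using dehomogenize_sum [of "\<lambda>\<mu>. single \<mu> (lookup F \<mu>)" "keys F"]
    by (simp add: sum_single_keys dehomogenize_single)
  then have "coeff (coeff (dehomogenize F) j) i =
      (\<Sum>\<mu>\<in>keys F. if lookup \<mu> 1 = i \<and> lookup \<mu> 2 = j then lookup F \<mu> else 0)"
    by (auto simp: coeff_sum intro!: sum.cong)
  also have "\<dots> = (\<Sum>\<mu>\<in>keys F. if \<mu> = exponent i j (t - i - j) then (if i + j \<le> t then lookup F \<mu> else 0) else 0)"
  \<comment> \<open>Within degree \<open>t\<close> the exponents of \<open>x\<^sub>1\<close> and
    \<open>x\<^sub>2\<close> determine the monomial; the guard \<open>i + j \<le> t\<close> excludes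
    truncated differences.\<close>
  proof (intro sum.cong refl)
    fix \<mu> assume "\<mu> \<in> keys F"
    then have t: "t = lookup \<mu> 1 + lookup \<mu> 2 + lookup \<mu> 3"
      using assms by (auto simp: forms_def sum_3)
    have "\<mu> = exponent i j (t - i - j) \<and> i + j \<le> t \<longleftrightarrow> lookup \<mu> 1 = i \<and> lookup \<mu> 2 = j"
    proof safe
      assume "i = lookup \<mu> 1" "j = lookup \<mu> 2"
      then show "\<mu> = exponent (lookup \<mu> 1) (lookup \<mu> 2) (t - lookup \<mu> 1 - lookup \<mu> 2)"
        using exponent_lookup [of \<mu>] t by simp
    next
      show "lookup \<mu> 1 + lookup \<mu> 2 \<le> t" using t by simp
    qed (metis lookup_exponent(1,2))+
    then show "(if lookup \<mu> 1 = i \<and> lookup \<mu> 2 = j then lookup F \<mu> else 0) =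
      (if \<mu> = exponent i j (t - i - j) then (if i + j \<le> t then lookup F \<mu> else 0) else 0)"
      by auto
  qed
  finally show ?thesis by (simp add: in_keys_iff)
qed

lemma dehomogenize_inject:
  assumes "F \<in> forms t" "G \<in> forms t" "dehomogenize F = dehomogenize G"
  shows "F = G"
proof (rule poly_mapping_eqI)
  fix \<mu>
  show "lookup F \<mu> = lookup G \<mu>"
  proof (cases "weight \<mu> = t")
    case True
    then have "t = lookup \<mu> 1 + lookup \<mu> 2 + lookup \<mu> 3" by (simp add: sum_3)
    then show ?thesis
      using coeff_dehomogenize [OF assms(1), of "lookup \<mu> 2" "lookup \<mu> 1"]
        coeff_dehomogenize [OF assms(2), of "lookup \<mu> 2" "lookup \<mu> 1"] assms(3)
      by (simp add: exponent_lookup)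
  qed (use assms forms_iff in metis)
qed

lemma dehomogenize_eq_0_iff:
  assumes "F \<in> forms t"
  shows "dehomogenize F = 0 \<longleftrightarrow> F = 0"
proof
  assume "dehomogenize F = 0"
  then have "dehomogenize F = dehomogenize 0" by simp
  then show "F = 0"
    by (rule dehomogenize_inject [OF assms poly.subspace_0 [OF subspace_forms]])
qed simp

lemma total_degree_dehomogenize: "F \<in> forms t \<Longrightarrow> total_degree (dehomogenize F) \<le> t"
  by (auto simp: total_degree_le_iff coeff_dehomogenize split: if_splits)

text \<open>Homogenization: every monomial is padded with a power of \<open>x\<^sub>0\<close> up to
  degree \<open>t\<close>, which may exceed the total degree of \<open>f\<close>.\<close>

lemma dehomogenize_surj:
  assumes "total_degree f \<le> t"
  obtains F where "F \<in> forms t" "dehomogenize F = f"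
proof -
  let ?F = "\<Sum>\<mu>\<in>{\<mu>. weight \<mu> = t}. single \<mu> (coeff (coeff f (lookup \<mu> 2)) (lookup \<mu> 1))"
  have F: "?F \<in> forms t"
    using subspace_forms by (intro poly.subspace_sum) (auto intro: single_in_forms)
  moreover have "lookup ?F \<mu> = coeff (coeff f (lookup \<mu> 2)) (lookup \<mu> 1)" if "weight \<mu> = t" for \<mu>
    using that finite_exponents_of_weight [of t] by (simp add: lookup_sum lookup_single when_def)
  then have "dehomogenize ?F = f"
    using assms by (auto simp: poly_eq_iff coeff_dehomogenize [OF F] total_degree_le_iff)
  ultimately show ?thesis using that by blast
qed

text \<open>Polynomials in two variables form a factorial ring, so the dehomogenized forms have a
  gcd with coprime cofactors, and these are homogenized again. Coprimality of \<open>G1\<close> and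
  \<open>G2\<close> is exported as a statement on syzygies: from degree \<open>k\<close> on, all are
  multiples of the trivial one. This is the form in which Bezout's bound uses it.\<close>

lemma forms_gcd:
  assumes F1: "F1 \<in> forms n" "F1 \<noteq> 0" and F2: "F2 \<in> forms n" "F2 \<noteq> 0"
  obtains k C G1 G2 where "k \<le> n" "C \<in> forms (n - k)" "G1 \<in> forms k" "G2 \<in> forms k"
    "F1 = C * G1" "F2 = C * G2"
    "\<And>j P Q. P \<in> forms j \<Longrightarrow> Q \<in> forms j \<Longrightarrow> P * G1 = Q * G2 \<Longrightarrow> k \<le> j \<Longrightarrow>
      \<exists>E\<in>forms (j - k). P = E * G2 \<and> Q = E * G1"
proof -
  let ?f1 = "dehomogenize F1" and ?f2 = "dehomogenize F2"
  have nz: "?f1 \<noteq> 0" "?f2 \<noteq> 0"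
    using F1 F2 by (simp_all add: dehomogenize_eq_0_iff [of _ n])
  define c where "c = gcd ?f1 ?f2"
  have c0: "c \<noteq> 0" using nz unfolding c_def gcd_eq_0_iff by blast
  obtain g1 g2 where g: "?f1 = g1 * c" "?f2 = g2 * c" "coprime g1 g2"
    using gcd_coprime_exists [OF c0 [unfolded c_def], folded c_def] by blast
  have nz': "g1 \<noteq> 0" "g2 \<noteq> 0" "c \<noteq> 0"
    using g(1,2) nz c0 by (metis mult_zero_left)+
  \<comment> \<open>The least degree in which both cofactors can be homogenized; a common power of
    \<open>x\<^sub>0\<close> in the two forms thereby goes into \<open>C\<close>.\<close>
  define k where "k = max (total_degree g1) (total_degree g2)"
  have ck: "total_degree c + k \<le> n"
    using total_degree_dehomogenize [OF F1(1)] total_degree_dehomogenize [OF F2(1)] nz'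
    by (auto simp: k_def g total_degree_mult)
  have deg: "total_degree c \<le> n - k" "total_degree g1 \<le> k" "total_degree g2 \<le> k"
    using ck by (simp_all add: k_def)
  obtain C where C: "C \<in> forms (n - k)" "dehomogenize C = c"
    by (rule dehomogenize_surj [OF deg(1)])
  obtain G1 where G1: "G1 \<in> forms k" "dehomogenize G1 = g1"
    by (rule dehomogenize_surj [OF deg(2)])
  obtain G2 where G2: "G2 \<in> forms k" "dehomogenize G2 = g2"
    by (rule dehomogenize_surj [OF deg(3)])
  have "k \<le> n" using ck by simp
  moreover have "F1 = C * G1"
    using F1 forms_mult [OF C(1) G1(1)] \<open>k \<le> n\<close> g
    by (intro dehomogenize_inject [of _ n]) (simp_all add: dehomogenize_mult C G1 mult.commute)
  moreover have "F2 = C * G2"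
    using F2 forms_mult [OF C(1) G2(1)] \<open>k \<le> n\<close> g
    by (intro dehomogenize_inject [of _ n]) (simp_all add: dehomogenize_mult C G2 mult.commute)
  moreover have "\<exists>E\<in>forms (j - k). P = E * G2 \<and> Q = E * G1"
    if P: "P \<in> forms j" and Q: "Q \<in> forms j" and eq: "P * G1 = Q * G2" and kj: "k \<le> j" for j P Q
  proof -
    let ?p = "dehomogenize P" and ?q = "dehomogenize Q"
    have pq: "?p * g1 = ?q * g2"
      using arg_cong [OF eq, of dehomogenize] by (simp add: dehomogenize_mult G1 G2)
    then have "g2 dvd g1 * ?p" by (metis dvd_triv_right mult.commute)
    then have "g2 dvd ?p" using g(3) by (metis coprime_commute coprime_dvd_mult_right_iff)
    then obtain e where e: "?p = g2 * e" by blast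
    then have q: "?q = g1 * e" using pq nz' by (simp add: algebra_simps)
    \<comment> \<open>The cofactor that attains the maximum \<open>k\<close> bounds the degree of
      \<open>e\<close>, through \<open>P\<close> or through \<open>Q\<close>.\<close>
    have deg_e: "total_degree e \<le> j - k"
    proof (cases "e = 0")
      case False
      then show ?thesis
        using total_degree_dehomogenize [OF P] total_degree_dehomogenize [OF Q] nz'
        by (auto simp: k_def e q total_degree_mult)
    qed (simp add: total_degree_def)
    obtain E where E: "E \<in> forms (j - k)" "dehomogenize E = e"
      by (rule dehomogenize_surj [OF deg_e])
    have "P = E * G2" "Q = E * G1"
      using P Q forms_mult [OF E(1) G2(1)] forms_mult [OF E(1) G1(1)] kj
      by (auto intro!: dehomogenize_inject [of _ j] simp: dehomogenize_mult e q E G1 G2)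
    then show ?thesis using E by blast
  qed
  ultimately show ?thesis using that C G1 G2 by blast
qed

section \<open>Points in the plane and relations between them\<close>

lemma evaluate_variable: "evaluate (single (single i 1) c) a = c * a $ i"
proof -
  have "(\<Prod>j\<in>UNIV. (a $ j) ^ lookup (single i 1) j) = (\<Prod>j\<in>UNIV. if j = i then a $ j else 1)"
    by (intro prod.cong) (auto simp: lookup_single)
  then show ?thesis by (simp add: evaluate_single)
qed

lemma weight_variable: "weight (single i 1) = 1"
  by (simp add: lookup_single when_def)

text \<open>Coordinate vectors of distinct points of the projective plane: nonzero, and pairwise
  non-proportional because some 2x2 minor is nonzero.\<close>

definition distinct_points :: "(complex ^ 3) set \<Rightarrow> bool"
  where "distinct_points Z \<longleftrightarrow> (\<forall>p\<in>Z. p \<noteq> 0) \<and>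
    (\<forall>p\<in>Z. \<forall>q\<in>Z. p \<noteq> q \<longrightarrow> (\<exists>i j. p $ i * q $ j \<noteq> p $ j * q $ i))"

lemma distinct_points_subset: "distinct_points Z \<Longrightarrow> Y \<subseteq> Z \<Longrightarrow> distinct_points Y"
  unfolding distinct_points_def by blast

lemma separating_linear_form:
  assumes "p $ i * q $ j \<noteq> p $ j * q $ i"
  obtains L where "L \<in> forms 1" "evaluate L p \<noteq> 0" "evaluate L q = 0"
proof
  \<comment> \<open>The minor in rows \<open>i\<close>, \<open>j\<close> of the generic point and
    \<open>q\<close>: zero at \<open>q\<close> itself, and nonzero at \<open>p\<close> by
    assumption.\<close>
  let ?L = "single (single i 1) (q $ j) - single (single j 1) (q $ i)"
  show "?L \<in> forms 1"
    using subspace_forms weight_variable by (intro poly.subspace_diff single_in_forms) auto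
  show "evaluate ?L p \<noteq> 0" "evaluate ?L q = 0"
    using assms unfolding evaluate_diff evaluate_variable by (simp_all add: mult.commute)
qed

text \<open>For each \<open>p\<close>, multiply lines through the other points that avoid
  \<open>p\<close>, and pad with a power of a coordinate that is nonzero at
  \<open>p\<close>.\<close>

lemma interpolating_large_degree:
  assumes Y: "finite Y" "distinct_points Y" and t: "card Y \<le> t"
  shows "interpolating t Y"
  unfolding interpolating_def
proof
  fix p assume p: "p \<in> Y"
  have "\<exists>L. L \<in> forms 1 \<and> evaluate L p \<noteq> 0 \<and> evaluate L q = 0" if "q \<in> Y - {p}" for q
    using Y(2) p that separating_linear_form [of p _ q] unfolding distinct_points_def by (metis DiffE singletonI)
  then obtain L where L: "\<And>q. q \<in> Y - {p} \<Longrightarrow> L q \<in> forms 1 \<and> evaluate (L q) p \<noteq> 0 \<and> evaluate (L q) q = 0"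
    by metis
  obtain i where i: "p $ i \<noteq> 0"
    using Y(2) p unfolding distinct_points_def by (metis vec_eq_iff zero_index)
  define M where "M = (single (single i 1) 1 :: ternary)"
  define e where "e = t - card (Y - {p})"
  define F where "F = (\<Prod>q\<in>Y - {p}. L q) * M ^ e"
  have "M ^ e \<in> forms e"
    using forms_power [of M 1 e] weight_variable by (simp add: M_def single_in_forms)
  moreover have "(\<Prod>q\<in>Y - {p}. L q) \<in> forms (card (Y - {p}))"
    using L Y by (intro forms_prod) auto
  moreover have "card (Y - {p}) + e = t"
    using t Y(1) card_mono [of Y "Y - {p}"] by (simp add: e_def)
  ultimately have F: "F \<in> forms t"
    unfolding F_def using forms_mult by metis
  have "evaluate F p \<noteq> 0"
    using L i Y(1) by (simp add: F_def evaluate_mult evaluate_prod evaluate_power M_def evaluate_variable [unfolded One_nat_def])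
  moreover have "evaluate F q = 0" if "q \<in> Y - {p}" for q
    using L that Y(1) by (auto simp: F_def evaluate_mult evaluate_prod)
  ultimately show "\<exists>F\<in>forms t. evaluate F p = 1 \<and> (\<forall>q\<in>Y - {p}. evaluate F q = 0)"
    using F subspace_forms [of t]
    by (intro bexI [of _ "scale (1 / evaluate F p) F"]) (auto simp: evaluate_scale poly.subspace_scale)
qed

section \<open>Bezout's bound by dimension counting\<close>

interpretation poly_pair: vector_space_pair scale scale
  by unfold_locales

lemma linear_times: "Vector_Spaces.linear scale scale ((*) G)"
  by (simp add: Vector_Spaces.linear_iff poly.vector_space_axioms scale_mult_right algebra_simps)

lemma dim_times_forms:
  assumes "G \<noteq> 0"
  shows "poly.dim ((*) G ` forms t) = (t + 2) choose 2"
proof -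
  obtain B where "finite B" "forms t \<subseteq> poly.span B" by (rule forms_finite_span)
  then obtain C where C: "finite C" "C \<subseteq> forms t" "poly.independent C" "poly.span C = forms t"
    "card C = poly.dim (forms t)"
    using poly.finite_basis_exists subspace_forms by metis
  have inj: "inj ((*) G)"
    using assms by (intro injI) simp
  have "poly.independent ((*) G ` C)"
    using C(3) inj linear_times by (intro poly_pair.linear_independent_injective_image) (auto simp: inj_on_def)
  moreover have "(*) G ` forms t = poly.span ((*) G ` C)"
    using poly_pair.linear_span_image [OF linear_times, of G C] C(4) by simp
  ultimately have "poly.dim ((*) G ` forms t) = card ((*) G ` C)"
    by (metis poly.dim_span_eq_card_independent)
  also have "\<dots> = card C" using inj by (intro card_image) (auto simp: inj_on_def)
  finally show ?thesis using C dim_forms by simp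
qed

lemma subspace_times_forms: "poly.subspace ((*) G ` forms t)"
  by (rule poly_pair.linear_subspace_image [OF linear_times subspace_forms])

lemma choose_two_times_two: "2 * ((n + 2) choose 2) = (n + 2) * (n + 1)"
proof -
  have "even ((n + 2) * (n + 1))" by simp
  then show ?thesis by (simp add: choose_two)
qed

text \<open>The multiples of \<open>G1\<close> and of \<open>G2\<close> in a large degree span a
  space of forms vanishing on \<open>Y\<close>. By the syzygy condition they meet only in the
  multiples of \<open>G1 * G2\<close>, so Grassmann's formula gives the dimension of the sum;
  comparing it with that of all forms vanishing on \<open>Y\<close> bounds
  \<open>card Y\<close>.\<close>

lemma bezout_le:
  assumes G: "G1 \<in> forms k" "G2 \<in> forms k" "G1 \<noteq> 0" "G2 \<noteq> 0"
    and syz: "\<And>j P Q. P \<in> forms j \<Longrightarrow> Q \<in> forms j \<Longrightarrow> P * G1 = Q * G2 \<Longrightarrow> k \<le> j \<Longrightarrow>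
      \<exists>E\<in>forms (j - k). P = E * G2 \<and> Q = E * G1"
    and Y: "finite Y" "distinct_points Y"
    and zero: "\<And>p. p \<in> Y \<Longrightarrow> evaluate G1 p = 0 \<and> evaluate G2 p = 0"
  shows "card Y \<le> k * k"
proof -
  let ?y = "card Y"
  \<comment> \<open>\<open>?t\<close> is at least \<open>card Y\<close>, so the points impose
    independent conditions in this degree; the cofactor of \<open>G1 * G2\<close> then has degree
    \<open>?y\<close>.\<close>
  let ?t = "2 * k + ?y" and ?j = "k + ?y"
  let ?U = "(*) G1 ` forms ?j" and ?W = "(*) G2 ` forms ?j"
  obtain B where B: "finite B" "forms ?t \<subseteq> poly.span B" by (rule forms_finite_span)
  have UW: "?U \<subseteq> forms ?t" "?W \<subseteq> forms ?t"
    using forms_mult [OF G(1), of _ ?j] forms_mult [OF G(2), of _ ?j] by (auto simp: mult_2 add.assoc)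
  have "?U \<inter> ?W = (*) (G1 * G2) ` forms ?y"
  proof safe
    fix P Q assume PQ: "P \<in> forms ?j" "Q \<in> forms ?j" "G1 * P = G2 * Q"
    then obtain E where "E \<in> forms ?y" "P = E * G2"
      using syz [of P ?j Q] by (auto simp: mult.commute)
    then show "G1 * P \<in> (*) (G1 * G2) ` forms ?y" by (auto simp: ac_simps)
  next
    fix E assume E: "E \<in> forms ?y"
    show "G1 * G2 * E \<in> ?U"
      using forms_mult [OF G(2) E] by (auto simp: mult.assoc)
    show "G1 * G2 * E \<in> ?W"
      using forms_mult [OF G(1) E] by (intro image_eqI [of _ _ "G1 * E"]) (auto simp: ac_simps)
  qed
  then have dim_Int: "poly.dim (?U \<inter> ?W) = (?y + 2) choose 2"
    using G dim_times_forms [of "G1 * G2" ?y] by simp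
  have "poly.dim {u + w | u w. u \<in> ?U \<and> w \<in> ?W} + poly.dim (?U \<inter> ?W) = poly.dim ?U + poly.dim ?W"
    using B UW by (intro poly.dim_sum_Int [of _ B]) (auto intro: subspace_times_forms)
  then have "poly.dim {u + w | u w. u \<in> ?U \<and> w \<in> ?W} + ((?y + 2) choose 2) = 2 * ((?j + 2) choose 2)"
    using dim_Int G by (simp add: dim_times_forms)
  moreover have "{u + w | u w. u \<in> ?U \<and> w \<in> ?W} \<subseteq> vanishing ?t Y"
    using UW zero subspace_forms [of ?t]
    by (auto simp: vanishing_def evaluate_add evaluate_mult intro!: poly.subspace_add)
  then have "poly.dim {u + w | u w. u \<in> ?U \<and> w \<in> ?W} \<le> poly.dim (vanishing ?t Y)"
    using vanishing_subset_forms by (rule dim_mono_forms)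
  moreover have "?y + poly.dim (vanishing ?t Y) = (?t + 2) choose 2"
    using hilbert_fun_add_dim [of ?t Y] interpolating_hilbert_fun [of Y ?t]
      interpolating_large_degree [of Y ?t] Y by simp
  ultimately have "?y + 2 * ((?j + 2) choose 2) \<le> ((?t + 2) choose 2) + ((?y + 2) choose 2)"
    by linarith
  then have "2 * ?y + 2 * ((?j + 2) * (?j + 1)) \<le> (?t + 2) * (?t + 1) + (?y + 2) * (?y + 1)"
    using choose_two_times_two [of ?j] choose_two_times_two [of ?t] choose_two_times_two [of ?y] by linarith
  then show ?thesis by (simp add: algebra_simps)
qed

section \<open>Relations of odd degree\<close>

lemma zero_of_dim_0:
  assumes "poly.dim (vanishing t Z) = 0" "F \<in> vanishing t Z"
  shows "F = 0"
proof -
  obtain B where "finite B" "forms t \<subseteq> poly.span B" by (rule forms_finite_span)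
  then obtain C where "finite C" "poly.span C = vanishing t Z" "card C = 0"
    using poly.finite_basis_exists [of "vanishing t Z" B] assms(1) subspace_vanishing vanishing_subset_forms
    by (metis order_trans)
  then show ?thesis using assms(2) by (metis card_0_eq empty_iff poly.span_empty singletonD)
qed

lemma two_independent_forms:
  assumes "2 \<le> poly.dim (vanishing t Z)"
  obtains F1 F2 where "F1 \<in> vanishing t Z" "F2 \<in> vanishing t Z" "F1 \<noteq> 0" "\<And>c. F2 \<noteq> scale c F1"
proof -
  obtain F1 where F1: "F1 \<in> vanishing t Z" "F1 \<noteq> 0"
  proof (rule ccontr)
    assume "\<not> thesis"
    then have "vanishing t Z \<subseteq> poly.span {}" using that by auto
    then have "poly.dim (vanishing t Z) \<le> card ({} :: ternary set)" by (rule poly.dim_le_card) simp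
    then show False using assms by simp
  qed
  have "\<not> vanishing t Z \<subseteq> poly.span {F1}"
  proof
    assume "vanishing t Z \<subseteq> poly.span {F1}"
    then have "poly.dim (vanishing t Z) \<le> card {F1}" by (rule poly.dim_le_card) simp
    then show False using assms by simp
  qed
  then obtain F2 where "F2 \<in> vanishing t Z" "F2 \<notin> range (\<lambda>c. scale c F1)"
    by (auto simp: poly.span_singleton)
  then show ?thesis using that F1 by blast
qed

lemma forms_0_scalar:
  assumes "G \<in> forms 0"
  obtains c where "G = scale c 1"
proof
  have "lookup G \<mu> = lookup (scale (lookup G 0) 1) \<mu>" for \<mu>
  proof (cases "\<mu> = 0")
    case False
    then have "weight \<mu> \<noteq> 0"
      by (metis finite lookup_zero poly_mapping_eqI sum_eq_0_iff UNIV_I)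
    then show ?thesis using assms False by (auto simp: forms_iff lookup_scale lookup_one when_def)
  qed (simp add: lookup_scale)
  then show "G = scale (lookup G 0) 1" by (rule poly_mapping_eqI)
qed

text \<open>The multiples of \<open>C\<close> vanish wherever \<open>C\<close> does; this limits how
  many conditions points on the curve can impose.\<close>

lemma dim_curve_le:
  assumes "C \<in> forms e" "C \<noteq> 0" "\<And>p. p \<in> J \<Longrightarrow> evaluate C p = 0"
  shows "(k + 2) choose 2 \<le> poly.dim (vanishing (e + k) J)"
proof -
  have "(*) C ` forms k \<subseteq> vanishing (e + k) J"
    using assms forms_mult by (auto simp: vanishing_def evaluate_mult)
  then have "poly.dim ((*) C ` forms k) \<le> poly.dim (vanishing (e + k) J)"
    using vanishing_subset_forms by (rule dim_mono_forms)
  then show ?thesis using assms(2) by (simp add: dim_times_forms)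
qed

text \<open>\<open>Z\<close> is the support of the relation between two decompositions and
  \<open>A\<close> the part of the given set inside it. If \<open>A\<close> is at most half of
  \<open>Z\<close>, the other decomposition must supply at least as many points.\<close>

lemma odd_degree_relation:
  assumes Z: "finite Z" "distinct_points Z" and \<tau>: "\<And>p. p \<in> Z \<Longrightarrow> \<tau> p \<noteq> 0"
    and rel: "\<And>F. F \<in> forms (2 * m + 1) \<Longrightarrow> (\<Sum>p\<in>Z. \<tau> p * evaluate F p) = 0"
    and A: "A \<subseteq> Z" "card A \<le> ((m + 2) choose 2) + (m + 1) div 2"
    and gen: "\<And>A'. A' \<subseteq> A \<Longrightarrow> card A' \<le> (m + 2) choose 2 \<Longrightarrow> interpolating m A'"
    and indep: "interpolating (m + 1) A"
  shows "2 * card A \<le> card Z"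
proof (rule ccontr)
  assume "\<not> 2 * card A \<le> card Z"
  then have less: "card Z < 2 * card A" by simp
  let ?N = "(m + 2) choose 2"
  have finA: "finite A" using A Z finite_subset by blast
  have hA: "hilbert_fun (m + 1) A = card A"
    using indep finA interpolating_hilbert_fun by blast
  have hZ: "hilbert_fun m Z + hilbert_fun (m + 1) Z \<le> card Z"
  proof (rule relation_hilbert_fun [of Z \<tau>, OF Z(1) \<tau>])
    fix F assume "F \<in> forms (m + (m + 1))"
    then have "F \<in> forms (2 * m + 1)" by (metis add.assoc mult_2)
    then show "(\<Sum>p\<in>Z. \<tau> p * evaluate F p) = 0" by (rule rel)
  qed
  have hAZ: "hilbert_fun t A \<le> hilbert_fun t Z" for t
    using A(1) by (rule hilbert_fun_mono)
  \<comment> \<open>Otherwise \<open>gen\<close> applies to \<open>A\<close> itself, and both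
    Hilbert functions of \<open>Z\<close> in \<open>hZ\<close> are at least
    \<open>card A\<close>.\<close>
  have big: "?N < card A"
  proof (rule ccontr)
    assume "\<not> ?N < card A"
    then have "hilbert_fun m A = card A"
      using gen [of A] finA interpolating_hilbert_fun by simp
    then show False using hZ hAZ [of m] hAZ [of "m + 1"] hA less by linarith
  qed
  have hmA: "?N \<le> hilbert_fun m A"
  proof -
    obtain A' where "A' \<subseteq> A" "card A' = ?N"
      using big by (metis less_imp_le obtain_subset_with_card_n)
    then show ?thesis
      using gen [of A'] interpolating_hilbert_fun [of A' m] hilbert_fun_mono [of A' A m] finA finite_subset
      by (metis order_refl)
  qed
  then have dim_mA: "poly.dim (vanishing m A) = 0"
    using hilbert_fun_add_dim [of m A] by simp
  define s where "s = card A - ?N"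
  have s: "card A = ?N + s" "1 \<le> s" "2 * s \<le> m + 1"
    using big A(2) by (auto simp: s_def)
  \<comment> \<open>From \<open>hZ\<close>, \<open>hilbert_fun (m + 1) Z\<close> is at most
    \<open>(2 * ?N + 2 * s - 1) - ?N\<close>, hence at most \<open>?N + m\<close>: two less than the
    dimension of all forms of degree \<open>m + 1\<close>.\<close>
  have "(m + 1 + 2) choose 2 = ?N + m + 2"
    using choose_two_times_two [of m] choose_two_times_two [of "m + 1"] by (simp add: algebra_simps)
  then have "2 \<le> poly.dim (vanishing (m + 1) Z)"
    using hilbert_fun_add_dim [of "m + 1" Z] hZ hmA hAZ [of m] less s by linarith
  then obtain F1 F2 where F: "F1 \<in> vanishing (m + 1) Z" "F2 \<in> vanishing (m + 1) Z" "F1 \<noteq> 0" "\<And>c. F2 \<noteq> scale c F1"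
    using two_independent_forms by blast
  have "F2 \<noteq> 0" using F(4) [of 0] by simp
  then obtain k C G1 G2 where k: "k \<le> m + 1" and C: "C \<in> forms (m + 1 - k)"
    and G: "G1 \<in> forms k" "G2 \<in> forms k" "F1 = C * G1" "F2 = C * G2"
    and syz: "\<And>j P Q. P \<in> forms j \<Longrightarrow> Q \<in> forms j \<Longrightarrow> P * G1 = Q * G2 \<Longrightarrow> k \<le> j \<Longrightarrow>
      \<exists>E\<in>forms (j - k). P = E * G2 \<and> Q = E * G1"
    using forms_gcd [of F1 "m + 1" F2] F unfolding vanishing_def by blast
  have nz: "C \<noteq> 0" "G1 \<noteq> 0" "G2 \<noteq> 0" using G F(3) \<open>F2 \<noteq> 0\<close> by auto
  have "k \<noteq> 0"
  proof
    assume "k = 0"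
    then obtain a b where ab: "G1 = scale a 1" "G2 = scale b 1"
      using G forms_0_scalar by metis
    then have "a \<noteq> 0" using nz by auto
    then have "F2 = scale (b / a) F1" by (simp add: G ab scale_mult_right)
    then show False using F(4) by blast
  qed
  \<comment> \<open>\<open>l = k - 1\<close> is complementary to the degree \<open>e\<close> of
    \<open>C\<close> in degree \<open>m\<close>, and \<open>K\<close> below is the dimension of the
    forms of degree \<open>l\<close>.\<close>
  then obtain l where l: "k = Suc l" using not0_implies_Suc by blast
  define e where "e = m + 1 - k"
  have e: "C \<in> forms e" "e + l = m" "e + (m + k) = 2 * m + 1" using C k l by (auto simp: e_def)
  define K where "K = (l + 2) choose 2"
  have K: "2 * K = k * k + k" using choose_two_times_two [of l] by (simp add: K_def l algebra_simps)
  define Y where "Y = {p \<in> Z. evaluate C p \<noteq> 0}"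
  have Y: "finite Y" "Y \<subseteq> Z" "distinct_points Y"
    using Z by (auto simp: Y_def intro: distinct_points_subset)
  have "evaluate G1 p = 0 \<and> evaluate G2 p = 0" if "p \<in> Y" for p
    using that F G by (auto simp: Y_def vanishing_def evaluate_mult)
  then have bezout: "card Y \<le> k * k"
    using bezout_le [OF G(1,2) nz(2,3) syz Y(1,3)] by blast
  \<comment> \<open>The points of \<open>A - Y\<close> lie on the curve \<open>C\<close>. Any
    \<open>?N - K + 1\<close> of them would impose independent conditions in degree \<open>m\<close>
    by \<open>gen\<close>, yet the multiples of \<open>C\<close> leave room for only
    \<open>?N - K\<close>.\<close>
  have "card (A - Y) + K \<le> ?N"
  proof (rule ccontr)
    assume "\<not> card (A - Y) + K \<le> ?N"
    moreover have "K \<le> ?N"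
      using choose_two_times_two [of l] choose_two_times_two [of m] k l mult_le_mono [of "l + 2" "m + 2" "l + 1" "m + 1"]
      unfolding K_def by linarith
    moreover have "1 \<le> K"
      using K l by (cases K) auto
    ultimately have "?N - K + 1 \<le> card (A - Y)" "?N - K + 1 \<le> ?N" by linarith+
    then obtain J where J: "J \<subseteq> A - Y" "card J = ?N - K + 1" "card J \<le> ?N"
      by (metis obtain_subset_with_card_n)
    then have "hilbert_fun m J = card J"
      using gen [of J] finA interpolating_hilbert_fun finite_subset by blast
    moreover have "K \<le> poly.dim (vanishing m J)"
      unfolding K_def e(2) [symmetric]
      using J A e(1) nz by (intro dim_curve_le) (auto simp: Y_def)
    ultimately show False
      using J hilbert_fun_add_dim [of m J] \<open>K \<le> ?N\<close> by linarith
  qed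
  moreover have "card A = card (A - Y) + card (A \<inter> Y)"
    using finA by (metis card_Diff_subset_Int card_mono finite_Int inf_le1 le_add_diff_inverse2)
  ultimately have cardAY: "s + K \<le> card (A \<inter> Y)" using s by linarith
  have "hilbert_fun l Y = K"
  proof -
    \<comment> \<open>At each point of \<open>A\<close> either \<open>C\<close> vanishes or the
      point is in \<open>Y\<close> and \<open>F\<close> vanishes; no nonzero form of degree
      \<open>m\<close> vanishes on \<open>A\<close>.\<close>
    have "F = 0" if "F \<in> vanishing l Y" for F
    proof -
      have "C * F \<in> vanishing m A"
        using that e forms_mult [of C e F l] A(1) by (auto simp: vanishing_def evaluate_mult Y_def)
      then have "C * F = 0" by (rule zero_of_dim_0 [OF dim_mA])
      then show ?thesis using nz by simp
    qed
    then have "vanishing l Y \<subseteq> {0}" by blast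
    then have "poly.dim (vanishing l Y) = 0"
      using poly.dim_le_card [of "vanishing l Y" "{}"] by simp
    then show ?thesis using hilbert_fun_add_dim [of l Y] by (simp add: K_def)
  qed
  moreover have "card (A \<inter> Y) \<le> hilbert_fun (m + 1) Y"
    using interpolating_hilbert_fun [of "A \<inter> Y" "m + 1"] interpolating_subset [OF indep, of "A \<inter> Y"]
      hilbert_fun_mono [of "A \<inter> Y" Y "m + 1"] finA by simp
  \<comment> \<open>Applied to multiples of \<open>C\<close>, the relation on \<open>Z\<close> loses
    its terms on the curve and keeps nonzero weights on \<open>Y\<close>.\<close>
  moreover have "hilbert_fun l Y + hilbert_fun (m + 1) Y \<le> card Y"
  proof (rule relation_hilbert_fun [of Y "\<lambda>p. \<tau> p * evaluate C p"])
    fix F assume "F \<in> forms (l + (m + 1))"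
    then have "C * F \<in> forms (e + (l + (m + 1)))" by (rule forms_mult [OF e(1)])
    moreover have "e + (l + (m + 1)) = 2 * m + 1" using e(2) by linarith
    ultimately have "C * F \<in> forms (2 * m + 1)" by (simp only:)
    then have "(\<Sum>p\<in>Z. \<tau> p * evaluate (C * F) p) = 0" by (rule rel)
    also have "(\<Sum>p\<in>Z. \<tau> p * evaluate (C * F) p) = (\<Sum>p\<in>Y. \<tau> p * evaluate C p * evaluate F p)"
      using Z(1) by (intro sum.mono_neutral_cong_right) (auto simp: Y_def evaluate_mult)
    finally show "(\<Sum>p\<in>Y. \<tau> p * evaluate C p * evaluate F p) = 0" .
  qed (use Y \<tau> in \<open>auto simp: Y_def\<close>)
  \<comment> \<open>The lower bound for \<open>card Y\<close> is
    \<open>K + (s + K) = k * k + k + s\<close>.\<close>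
  ultimately show False
    using bezout cardAY K s by linarith
qed

section \<open>Apolarity\<close>

definition linear_form :: "complex ^ 3 \<Rightarrow> ternary"
  where "linear_form a = (\<Sum>i\<in>UNIV. single (single i 1) (a $ i))"

lemma linear_form_in_forms: "linear_form a \<in> forms 1"
  unfolding linear_form_def
  using subspace_forms weight_variable by (intro poly.subspace_sum single_in_forms) auto

lemma lookup_linear_form: "lookup (linear_form a) (single i 1) = a $ i"
proof -
  have "lookup (linear_form a) (single i 1) = (\<Sum>j\<in>UNIV. if j = i then a $ j else 0)"
    unfolding linear_form_def lookup_sum
    by (intro sum.cong refl) (auto simp: lookup_single when_def dest: arg_cong [of _ _ keys])
  then show ?thesis by simp
qed

lemma lookup_single_times: "lookup (single \<nu> c * F) \<mu> = (\<Sum>\<kappa>\<in>keys F. if \<nu> + \<kappa> = \<mu> then c * lookup F \<kappa> else 0)"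
proof -
  have "single \<nu> c * F = (\<Sum>\<kappa>\<in>keys F. single (\<nu> + \<kappa>) (c * lookup F \<kappa>))"
    using sum_distrib_left [of "single \<nu> c" "\<lambda>\<kappa>. single \<kappa> (lookup F \<kappa>)" "keys F"]
    by (simp add: sum_single_keys mult_single)
  then show ?thesis by (simp add: lookup_sum lookup_single when_def)
qed

lemma lookup_single_times_add: "lookup (single \<nu> c * F) (\<nu> + \<kappa>) = c * lookup F (\<kappa> :: 3 \<Rightarrow>\<^sub>0 nat)"
  by (auto simp: lookup_single_times in_keys_iff)

lemma lookup_variable_times_0:
  assumes "lookup \<mu> i = 0"
  shows "lookup (single (single i (1 :: nat)) c * F) \<mu> = 0"
proof -
  have "single i (1 :: nat) + \<kappa> \<noteq> \<mu>" for \<kappa>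
    using assms by (auto simp: lookup_add)
  then show ?thesis by (simp add: lookup_single_times)
qed

text \<open>\<open>M\<close> is the multinomial coefficient. Only its positivity matters, so it is
  built by recursion on \<open>d\<close> instead of by factorials.\<close>

lemma power_linear_form_coeff:
  obtains M :: "(3 \<Rightarrow>\<^sub>0 nat) \<Rightarrow> nat" where
    "\<And>\<mu>. weight \<mu> = d \<Longrightarrow> M \<mu> > 0"
    "\<And>a \<mu>. weight \<mu> = d \<Longrightarrow> lookup (linear_form a ^ d) \<mu> = of_nat (M \<mu>) * evaluate (single \<mu> 1) a"
proof -
  have "\<exists>M :: (3 \<Rightarrow>\<^sub>0 nat) \<Rightarrow> nat. \<forall>\<mu>. weight \<mu> = d \<longrightarrow> M \<mu> > 0 \<and>
    (\<forall>a. lookup (linear_form a ^ d) \<mu> = of_nat (M \<mu>) * evaluate (single \<mu> 1) a)"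
  proof (induction d)
    case 0
    have *: "\<mu> = 0" if "weight \<mu> = 0" for \<mu> :: "3 \<Rightarrow>\<^sub>0 nat"
      using that by (intro poly_mapping_eqI) simp
    show ?case by (intro exI [of _ "\<lambda>_. 1"] allI impI) (drule *, simp)
  next
    case (Suc d)
    then obtain M :: "(3 \<Rightarrow>\<^sub>0 nat) \<Rightarrow> nat" where M: "\<And>\<mu>. weight \<mu> = d \<Longrightarrow> M \<mu> > 0"
      "\<And>\<mu> a. weight \<mu> = d \<Longrightarrow> lookup (linear_form a ^ d) \<mu> = of_nat (M \<mu>) * evaluate (single \<mu> 1) a"
      by blast
    \<comment> \<open>Pascal's rule from splitting off one linear factor; the guard drops variables
      absent from the monomial, where the difference would truncate.\<close>
    define M' where "M' \<mu> = (\<Sum>i\<in>UNIV. if lookup \<mu> i > 0 then M (\<mu> - single i 1) else 0)" for \<mu>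
    have minus: "\<mu> = single i 1 + (\<mu> - single i 1)" if "lookup \<mu> i > 0" for \<mu> :: "3 \<Rightarrow>\<^sub>0 nat" and i
      using that by (intro poly_mapping_eqI)
        (auto simp: lookup_add minus_poly_mapping.rep_eq lookup_single when_def)
    have weight_minus: "weight (\<mu> - single i 1) = d" if "lookup \<mu> i > 0" "weight \<mu> = Suc d" for \<mu> i
      using weight_add [of "single i 1" "\<mu> - single i 1"] minus [OF that(1)] that(2) weight_variable [of i]
      by simp
    show ?case
    proof (intro exI [of _ M'] allI impI conjI)
      fix \<mu> :: "3 \<Rightarrow>\<^sub>0 nat" assume \<mu>: "weight \<mu> = Suc d"
      then obtain i where "lookup \<mu> i > 0"
        by (metis gr0I nat.distinct(1) sum.neutral)
      then show "M' \<mu> > 0"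
        using M(1) weight_minus \<mu> unfolding M'_def by (intro sum_pos2 [of _ i]) auto
      fix a
      have "lookup (linear_form a ^ Suc d) \<mu> =
          (\<Sum>i\<in>UNIV. lookup (single (single i 1) (a $ i) * linear_form a ^ d) \<mu>)"
        by (simp add: linear_form_def sum_distrib_right lookup_sum)
      also have "\<dots> = (\<Sum>i\<in>UNIV. of_nat (if lookup \<mu> i > 0 then M (\<mu> - single i 1) else 0) * evaluate (single \<mu> 1) a)"
      proof (intro sum.cong refl)
        fix i
        show "lookup (single (single i 1) (a $ i) * linear_form a ^ d) \<mu> =
          of_nat (if lookup \<mu> i > 0 then M (\<mu> - single i 1) else 0) * evaluate (single \<mu> 1) a"
        proof (cases "lookup \<mu> i > 0")
          case True
          let ?\<kappa> = "\<mu> - single i 1"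
          have "evaluate (single \<mu> 1) a = evaluate (single (single i 1) 1 * single ?\<kappa> 1) a"
            using minus [OF True] by (simp add: mult_single)
          also have "\<dots> = a $ i * evaluate (single ?\<kappa> 1) a"
            unfolding evaluate_mult evaluate_variable by simp
          finally have ev: "evaluate (single \<mu> 1) a = a $ i * evaluate (single ?\<kappa> 1) a" .
          have "lookup (single (single i 1) (a $ i) * linear_form a ^ d) \<mu> = a $ i * lookup (linear_form a ^ d) ?\<kappa>"
            using lookup_single_times_add [of "single i 1" "a $ i" "linear_form a ^ d" ?\<kappa>] minus [OF True] by simp
          then show ?thesis
            using True M(2) [OF weight_minus [OF True \<mu>], of a] ev by simp
        next
          case False
          then show ?thesis using lookup_variable_times_0 [of \<mu> i] by simp
        qed
      qed
      also have "\<dots> = of_nat (M' \<mu>) * evaluate (single \<mu> 1) a"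
        by (simp only: M'_def of_nat_sum sum_distrib_right)
      finally show "lookup (linear_form a ^ Suc d) \<mu> = of_nat (M' \<mu>) * evaluate (single \<mu> 1) a" .
    qed
  qed
  then show ?thesis using that by blast
qed

text \<open>The coefficient of a monomial in the sum of powers is a positive multinomial coefficient
  times the same combination of the values of that monomial, and monomials span the forms of degree
  \<open>d\<close>.\<close>

lemma apolarity:
  "(\<Sum>i\<in>I. scale (c i) (linear_form (v i) ^ d)) = 0 \<longleftrightarrow>
    (\<forall>F\<in>forms d. (\<Sum>i\<in>I. c i * evaluate F (v i)) = 0)" (is "?S = 0 \<longleftrightarrow> _")
proof -
  obtain M :: "(3 \<Rightarrow>\<^sub>0 nat) \<Rightarrow> nat" where M: "\<And>\<mu>. weight \<mu> = d \<Longrightarrow> M \<mu> > 0"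
    "\<And>a \<mu>. weight \<mu> = d \<Longrightarrow> lookup (linear_form a ^ d) \<mu> = of_nat (M \<mu>) * evaluate (single \<mu> 1) a"
    using power_linear_form_coeff [of d] by blast
  have S: "lookup ?S \<mu> = of_nat (M \<mu>) * (\<Sum>i\<in>I. c i * evaluate (single \<mu> 1) (v i))" if "weight \<mu> = d" for \<mu>
    by (simp add: lookup_sum lookup_scale M(2) [OF that] sum_distrib_left mult_ac)
  show ?thesis
  proof
    assume S0: "?S = 0"
    show "\<forall>F\<in>forms d. (\<Sum>i\<in>I. c i * evaluate F (v i)) = 0"
    proof
      fix F assume F: "F \<in> forms d"
      have "(\<Sum>i\<in>I. c i * evaluate F (v i)) =
          (\<Sum>i\<in>I. \<Sum>\<mu>\<in>keys F. lookup F \<mu> * (c i * evaluate (single \<mu> 1) (v i)))"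
        by (simp add: evaluate_def [of F] evaluate_single sum_distrib_left mult_ac)
      also have "\<dots> = (\<Sum>\<mu>\<in>keys F. lookup F \<mu> * (\<Sum>i\<in>I. c i * evaluate (single \<mu> 1) (v i)))"
        by (subst sum.swap) (simp add: sum_distrib_left)
      also have "\<dots> = 0"
      proof (intro sum.neutral ballI)
        fix \<mu> assume "\<mu> \<in> keys F"
        then have "weight \<mu> = d" using F by (auto simp: forms_def)
        then show "lookup F \<mu> * (\<Sum>i\<in>I. c i * evaluate (single \<mu> 1) (v i)) = 0"
          using S [of \<mu>] M(1) [of \<mu>] S0 by simp
      qed
      finally show "(\<Sum>i\<in>I. c i * evaluate F (v i)) = 0" .
    qed
  next
    assume R: "\<forall>F\<in>forms d. (\<Sum>i\<in>I. c i * evaluate F (v i)) = 0"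
    have "linear_form (v i) ^ d \<in> forms d" for i
      using forms_power [OF linear_form_in_forms, of "v i" d] by simp
    then have "?S \<in> forms d"
      using subspace_forms by (intro poly.subspace_sum poly.subspace_scale) auto
    moreover have "lookup ?S \<mu> = 0" if "weight \<mu> = d" for \<mu>
      using S [OF that] R single_in_forms [OF that] by simp
    ultimately show "?S = 0"
      unfolding forms_iff by (intro poly_mapping_eqI) auto
  qed
qed

section \<open>Interpolation from independent powers and from the Hilbert function\<close>

lemma interpolating_missing_point:
  assumes "finite Z" "\<not> interpolating t Z"
  obtains J E where "J \<subset> Z" "finite J"
    "\<forall>F\<in>forms t. \<forall>p\<in>Z. evaluate F p = (\<Sum>q\<in>J. evaluate F q * evaluate (E q) p)"
proof -
  obtain J where J: "J \<subseteq> Z" "interpolating t J" "vanishing t J = vanishing t Z"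
    using maximal_interpolating assms(1) by blast
  have finJ: "finite J" using J(1) assms(1) finite_subset by blast
  obtain E where E: "\<And>q. q \<in> J \<Longrightarrow> E q \<in> forms t \<and> evaluate (E q) q = 1 \<and> (\<forall>x\<in>J - {q}. evaluate (E q) x = 0)"
    using J(2) unfolding interpolating_def by metis
  have "evaluate F p = (\<Sum>q\<in>J. evaluate F q * evaluate (E q) p)" if F: "F \<in> forms t" and p: "p \<in> Z" for F p
  proof -
    \<comment> \<open>\<open>F\<close> minus its Lagrange interpolant on \<open>J\<close> vanishes
      on \<open>J\<close>, hence on \<open>Z\<close> by the choice of \<open>J\<close>.\<close>
    let ?G = "F - (\<Sum>q\<in>J. scale (evaluate F q) (E q))"
    have "?G \<in> forms t"
      using F E subspace_forms [of t]
      by (intro poly.subspace_diff poly.subspace_sum poly.subspace_scale) auto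
    moreover have "evaluate ?G x = 0" if x: "x \<in> J" for x
    proof -
      have "(\<Sum>q\<in>J. evaluate F q * evaluate (E q) x) = (\<Sum>q\<in>J. if q = x then evaluate F q else 0)"
        using E x by (intro sum.cong) auto
      then show ?thesis
        using x finJ by (simp add: evaluate_diff evaluate_sum evaluate_scale)
    qed
    ultimately have "?G \<in> vanishing t Z" using J(3) by (auto simp: vanishing_def)
    then have "evaluate ?G p = 0" using p by (auto simp: vanishing_def)
    then show ?thesis by (simp add: evaluate_diff evaluate_sum evaluate_scale)
  qed
  moreover have "J \<subset> Z" using J assms(2) by blast
  ultimately show ?thesis using that finJ by blast
qed

lemma independent_powers_interpolating:
  assumes A: "finite A" and inj: "inj_on (\<lambda>a. linear_form a ^ m) A"
    and ind: "poly.independent ((\<lambda>a. linear_form a ^ m) ` A)"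
  shows "interpolating m A"
proof (rule ccontr)
  let ?f = "\<lambda>a. linear_form a ^ m"
  assume not_interp: "\<not> interpolating m A"
  obtain J E where J: "J \<subset> A" "finite J" and
    E: "\<forall>F\<in>forms m. \<forall>p\<in>A. evaluate F p = (\<Sum>q\<in>J. evaluate F q * evaluate (E q) p)"
    by (rule interpolating_missing_point [OF A not_interp])
  obtain p where p: "p \<in> A" "p \<notin> J" using J(1) by blast
  \<comment> \<open>Evaluation at \<open>p\<close> minus its expression through \<open>J\<close>,
    extended by zero; apolarity turns this into a linear relation between the powers.\<close>
  define c where "c a = (if a = p then 1 else if a \<in> J then - evaluate (E a) p else 0)" for a
  have "(\<Sum>a\<in>A. c a * evaluate F a) = 0" if "F \<in> forms m" for F
  proof -
    have "(\<Sum>a\<in>A. c a * evaluate F a) = (\<Sum>a\<in>insert p J. c a * evaluate F a)"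
      using A J p by (intro sum.mono_neutral_right) (auto simp: c_def)
    also have "\<dots> = evaluate F p + (\<Sum>a\<in>J. c a * evaluate F a)"
      using J p by (simp add: c_def)
    also have "(\<Sum>a\<in>J. c a * evaluate F a) = (\<Sum>a\<in>J. - (evaluate F a * evaluate (E a) p))"
      using p by (intro sum.cong) (auto simp: c_def)
    also have "evaluate F p + \<dots> = 0"
      using E [rule_format, OF that p(1)] by (simp add: sum_negf)
    finally show ?thesis .
  qed
  then have rel: "(\<Sum>a\<in>A. scale (c a) (?f a)) = 0"
    using apolarity [of c "\<lambda>a. a" m A] by blast
  have inv: "the_inv_into A ?f (linear_form a ^ m) = a" if "a \<in> A" for a
    using the_inv_into_f_f [OF inj that] .
  have "(\<Sum>v\<in>?f ` A. scale (c (the_inv_into A ?f v)) v) = 0"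
    using rel by (simp add: sum.reindex [OF inj] inv cong: sum.cong)
  then have "c (the_inv_into A ?f (?f p)) = 0"
    using p A by (intro poly.independentD [OF ind]) auto
  then show False
    using inv [OF p(1)] by (simp add: c_def)
qed

text \<open>If interpolation failed, the Lagrange forms of a smaller set \<open>J\<close> would
  already span the image of the evaluation map.\<close>

lemma hilbert_interpolating:
  assumes A: "finite A" and inj: "inj_on coords A" and h: "hilbert A j = card A"
  shows "interpolating j (coords ` A)"
proof (rule ccontr)
  assume not_interp: "\<not> interpolating j (coords ` A)"
  obtain J E where J: "J \<subset> coords ` A" "finite J" and
    E: "\<forall>F\<in>forms j. \<forall>p\<in>coords ` A. evaluate F p = (\<Sum>q\<in>J. evaluate F q * evaluate (E q) p)"
    by (rule interpolating_missing_point [OF finite_imageI [OF A] not_interp])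
  have "eval_map A ` forms j \<subseteq> func.span ((\<lambda>q. eval_map A (E q)) ` J)"
  proof (rule image_subsetI)
    fix F assume F: "F \<in> forms j"
    have sum_fun: "(\<Sum>q\<in>J. g q) p = (\<Sum>q\<in>J. g q p)" for g :: "complex ^ 3 \<Rightarrow> ternary set \<Rightarrow> complex" and p
      using J(2) by (induction J rule: finite_induct) auto
    have "eval_map A F = (\<Sum>q\<in>J. scale_fun (evaluate F q) (eval_map A (E q)))"
      using E [rule_format, OF F] by (auto simp: fun_eq_iff sum_fun scale_fun_def eval_map_def)
    also have "\<dots> \<in> func.span ((\<lambda>q. eval_map A (E q)) ` J)"
      by (intro func.span_sum func.span_scale func.span_base) auto
    finally show "eval_map A F \<in> func.span ((\<lambda>q. eval_map A (E q)) ` J)" .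
  qed
  then have "hilbert A j \<le> card ((\<lambda>q. eval_map A (E q)) ` J)"
    unfolding hilbert_def using J(2) by (intro func.dim_le_card) auto
  also have "\<dots> \<le> card J" using J(2) by (rule card_image_le)
  also have "\<dots> < card (coords ` A)" using J A by (intro psubset_card_mono) auto
  also have "\<dots> = card A" using inj by (rule card_image)
  finally show False using h by simp
qed

section \<open>Decompositions of forms\<close>

lemma linear_form_coefficients:
  assumes "F \<in> forms 1"
  shows "linear_form (\<chi> i. lookup F (single i 1)) = F"
proof (rule poly_mapping_eqI)
  fix \<mu>
  show "lookup (linear_form (\<chi> i. lookup F (single i 1))) \<mu> = lookup F \<mu>"
  proof (cases "weight \<mu> = 1")
    case True
    then obtain i where i: "lookup \<mu> i = 1" "\<And>j. i \<noteq> j \<Longrightarrow> lookup \<mu> j = 0"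
      unfolding sum_eq_1_iff [OF finite] by blast
    have "\<mu> = single i 1"
    proof (rule poly_mapping_eqI)
      fix j show "lookup \<mu> j = lookup (single i 1) j"
        using i by (cases "i = j") (auto simp: lookup_single when_def)
    qed
    then show ?thesis by (simp only: lookup_linear_form vec_lambda_beta)
  next
    case False
    then have "lookup G \<mu> = 0" if "G \<in> forms 1" for G
      using that unfolding forms_iff by blast
    then show ?thesis using assms linear_form_in_forms by simp
  qed
qed

lemma scale_single: "scale c (single \<mu> b) = single \<mu> (c * b)"
  unfolding scale_def mult_single by simp

lemma linear_form_scaled: "linear_form (c *s a) = scale c (linear_form a)"
  unfolding linear_form_def poly.scale_sum_right scale_single vector_smult_component by (rule refl)

lemma proj_pt_self: "F \<in> proj_pt F"
  unfolding proj_pt_def by (rule CollectI, rule exI [of _ 1]) simp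

lemma proj_pt_scale:
  assumes "c \<noteq> 0"
  shows "proj_pt (scale c F) = proj_pt F"
proof safe
  fix G assume "G \<in> proj_pt (scale c F)"
  then obtain e where "e \<noteq> 0" "G = scale (e * c) F" by (auto simp: proj_pt_def)
  then show "G \<in> proj_pt F" using assms by (auto simp: proj_pt_def)
next
  fix G assume "G \<in> proj_pt F"
  then obtain e where "e \<noteq> 0" "G = scale e F" by (auto simp: proj_pt_def)
  then have "G = scale (e / c) (scale c F)" "e / c \<noteq> 0" using assms by auto
  then show "G \<in> proj_pt (scale c F)" unfolding proj_pt_def by blast
qed

lemma plane_coords:
  assumes "p \<in> plane"
  shows "coords p \<noteq> 0" "proj_pt (linear_form (coords p)) = p"
proof -
  obtain L where L: "L \<in> forms 1" "L \<noteq> 0" "p = proj_pt L"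
    using assms unfolding projectivization_def by blast
  have "(SOME L. L \<in> p) \<in> proj_pt L" unfolding L(3) by (rule someI [of _ L], rule proj_pt_self)
  then obtain c where c: "c \<noteq> 0" "(SOME L. L \<in> p) = scale c L"
    unfolding proj_pt_def by blast
  have "scale c L \<in> forms 1" using L(1) subspace_forms poly.subspace_scale by blast
  then have lin: "linear_form (coords p) = scale c L"
    unfolding coords_def c(2) by (rule linear_form_coefficients)
  then show "proj_pt (linear_form (coords p)) = p" using proj_pt_scale c L(3) by simp
  show "coords p \<noteq> 0"
  proof
    assume "coords p = 0"
    then have "scale c L = 0" using lin by (simp add: linear_form_def)
    then show False using c L by simp
  qed
qed

lemma inj_on_coords: "A \<subseteq> plane \<Longrightarrow> inj_on coords A"
  using plane_coords(2) by (intro inj_on_inverseI [of _ "\<lambda>a. proj_pt (linear_form a)"]) (simp add: subset_iff)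

lemma distinct_points_coords:
  assumes "A \<subseteq> plane"
  shows "distinct_points (coords ` A)"
  unfolding distinct_points_def
proof (intro conjI ballI impI)
  fix a assume "a \<in> coords ` A"
  then obtain p where "p \<in> plane" "a = coords p" using assms by blast
  then show "a \<noteq> 0" using plane_coords(1) by simp
next
  fix a b assume ab: "a \<in> coords ` A" "b \<in> coords ` A" "a \<noteq> b"
  then obtain p q where pq: "p \<in> plane" "q \<in> plane" "a = coords p" "b = coords q" "p \<noteq> q"
    using assms by blast
  show "\<exists>i j. a $ i * b $ j \<noteq> a $ j * b $ i"
  proof (rule ccontr)
    assume "\<not> ?thesis"
    then have minors: "a $ i * b $ j = a $ j * b $ i" for i j by blast
    obtain i where i: "b $ i \<noteq> 0"
      using plane_coords(1) [OF pq(2)] pq(4) by (auto simp: vec_eq_iff)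
    \<comment> \<open>With all minors zero the vectors are proportional, so they represent the same
      point of the plane.\<close>
    have a: "a = (a $ i / b $ i) *s b"
      using minors i by (simp add: vec_eq_iff field_simps)
    have c: "a $ i / b $ i \<noteq> 0"
    proof
      assume "a $ i / b $ i = 0"
      with a have "a = 0" by (simp only: vector_smult_lzero)
      then show False using plane_coords(1) [OF pq(1)] pq(3) by simp
    qed
    have "proj_pt (linear_form a) = proj_pt (linear_form b)"
      by (subst a) (simp only: linear_form_scaled proj_pt_scale [OF c])
    then show False
      using plane_coords(2) [OF pq(1)] plane_coords(2) [OF pq(2)] pq(3,4,5) by simp
  qed
qed

section \<open>Spans of Veronese images and Kruskal ranks\<close>

definition power_form :: "nat \<Rightarrow> ternary set \<Rightarrow> ternary"
  where "power_form d p = linear_form (coords p) ^ d"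

lemma span_veronese:
  assumes "A \<subseteq> plane"
  shows "poly.span (\<Union>(veronese d ` A)) = poly.span (power_form d ` A)"
proof -
  have v: "veronese d p = proj_pt (power_form d p)" if "p \<in> A" for p
    using veronese_proj_pt [of d "linear_form (coords p)"] plane_coords(2) [of p] that assms
    by (auto simp: power_form_def)
  show ?thesis
  proof
    show "poly.span (\<Union>(veronese d ` A)) \<subseteq> poly.span (power_form d ` A)"
      by (intro poly.span_minimal poly.subspace_span)
        (auto simp: v proj_pt_def intro: poly.span_scale poly.span_base)
    show "poly.span (power_form d ` A) \<subseteq> poly.span (\<Union>(veronese d ` A))"
      using v proj_pt_self by (intro poly.span_mono) blast
  qed
qed

lemma proj_pt_in_proj_span:
  assumes "A \<subseteq> plane" "F \<noteq> 0"
  shows "proj_pt F \<in> proj_span (veronese d ` A) \<longleftrightarrow> F \<in> poly.span (power_form d ` A)"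
proof
  assume "proj_pt F \<in> proj_span (veronese d ` A)"
  then obtain G where G: "G \<in> poly.span (power_form d ` A)" "proj_pt F = proj_pt G"
    by (auto simp: proj_span_def projectivization_def span_veronese [OF assms(1)])
  then have "F \<in> proj_pt G" using proj_pt_self by metis
  then show "F \<in> poly.span (power_form d ` A)"
    using G(1) by (auto simp: proj_pt_def intro: poly.span_scale)
next
  assume "F \<in> poly.span (power_form d ` A)"
  then show "proj_pt F \<in> proj_span (veronese d ` A)"
    using assms by (auto simp: proj_span_def projectivization_def span_veronese)
qed

lemma (in vector_space) span_image_coefficients:
  assumes "finite A" "x \<in> span (f ` A)"
  obtains c where "x = (\<Sum>a\<in>A. scale (c a) (f a))"
proof -
  have "\<exists>c. x = (\<Sum>a\<in>A. scale (c a) (f a))"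
    using assms
  proof (induction A arbitrary: x rule: finite_induct)
    case (insert b A)
    then obtain k where "x - scale k (f b) \<in> span (f ` A)"
      by (auto simp: span_breakdown_eq)
    then obtain c where c: "x - scale k (f b) = (\<Sum>a\<in>A. scale (c a) (f a))"
      using insert.IH by blast
    have "(\<Sum>a\<in>insert b A. scale ((c(b := k)) a) (f a)) = scale k (f b) + (\<Sum>a\<in>A. scale (c a) (f a))"
      using insert.hyps by (auto intro!: sum.cong)
    also have "\<dots> = x" by (simp flip: c)
    finally show ?case by (intro exI [of _ "c(b := k)"]) simp
  qed simp
  then show ?thesis using that by blast
qed

text \<open>A repeated value of \<open>f\<close>, or a vector in the span of the others, would leave
  a spanning set with fewer than \<open>card A\<close> elements.\<close>

lemma (in vector_space) independent_if_dim_eq_card: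
  assumes "finite A" "dim (f ` A) = card A"
  shows "independent (f ` A)" "inj_on f A"
proof -
  have "dim (f ` A) \<le> card (f ` A)"
    using assms(1) span_superset by (intro dim_le_card) auto
  then show "inj_on f A"
    using assms card_image_le [of A f] by (intro eq_card_imp_inj_on) auto
  then have card: "card (f ` A) = card A" by (rule card_image)
  show "independent (f ` A)"
  proof
    assume "dependent (f ` A)"
    then obtain x where x: "x \<in> f ` A" "x \<in> span (f ` A - {x})"
      by (auto simp: dependent_def)
    have "f ` A \<subseteq> span (f ` A - {x})"
    proof
      fix y assume "y \<in> f ` A"
      then show "y \<in> span (f ` A - {x})"
        using x(2) by (cases "y = x") (simp_all add: span_base)
    qed
    then have "dim (f ` A) \<le> card (f ` A - {x})"
      using assms(1) by (intro dim_le_card) auto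
    also have "\<dots> < card (f ` A)"
      using x(1) assms(1) by (intro psubset_card_mono) auto
    finally show False using card assms(2) by simp
  qed
qed

lemma interpolating_if_dim:
  assumes A: "A \<subseteq> plane" "finite A" and dim: "proj_span_dim (veronese m ` A) = int (card A) - 1"
  shows "interpolating m (coords ` A)"
proof -
  have "poly.dim (power_form m ` A) = card A"
    using dim poly.span_eq_dim [OF span_veronese [OF A(1), of m]] by (simp add: proj_span_dim_def)
  note ind = poly.independent_if_dim_eq_card [OF A(2) this]
  have "(\<lambda>a. linear_form a ^ m) ` coords ` A = power_form m ` A"
    by (auto simp: power_form_def)
  moreover have "inj_on (\<lambda>a. linear_form a ^ m) (coords ` A)"
    using ind(2) unfolding inj_on_def power_form_def by blast
  ultimately show ?thesis
    using ind(1) A(2) by (intro independent_powers_interpolating) auto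
qed

lemma kruskal_rank_interpolating:
  assumes A: "A \<subseteq> plane" "finite A" and A': "A' \<subseteq> A" "card A' \<le> kruskal_rank m A"
  shows "interpolating m (coords ` A')"
proof -
  let ?K = "{k. k \<le> card A \<and>
    (\<forall>A' \<subseteq> A. card A' \<le> k \<longrightarrow> proj_span_dim (veronese m ` A') = int (card A') - 1)}"
  have "finite ?K" by (rule finite_subset [of _ "{..card A}"]) auto
  \<comment> \<open>The empty set spans the empty projective space, of dimension -1; so the maximum
    is over a nonempty set and is attained.\<close>
  moreover have "0 \<in> ?K"
  proof -
    have "poly.dim {} = 0" using poly.dim_le_card [of "{}" "{}"] by simp
    then have "proj_span_dim (veronese m ` A') = int (card A') - 1" if "A' \<subseteq> A" "card A' \<le> 0" for A'
      using that finite_subset [OF _ A(2), of A'] by (simp add: proj_span_dim_def)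
    then show ?thesis by blast
  qed
  ultimately have "kruskal_rank m A \<in> ?K"
    unfolding kruskal_rank_def by (intro Max_in) auto
  then have "proj_span_dim (veronese m ` A') = int (card A') - 1"
    using A' by blast
  then show ?thesis
    using A A' by (intro interpolating_if_dim) (auto intro: finite_subset)
qed

text \<open>Two decompositions of \<open>T\<close> differ by a relation with support
  \<open>Z\<close>. By \<open>large\<close>, \<open>A\<close> fills at most half of
  \<open>Z\<close>, so \<open>B\<close> has at least as many points there; outside \<open>Z\<close>
  every point of \<open>A\<close> also belongs to \<open>B\<close>.\<close>

lemma computes_rank_if_relations_large:
  assumes comp: "computes d A T" and nonred: "non_redundant d A T"
    and large: "\<And>Z \<tau> A'. \<lbrakk>finite Z; distinct_points Z; \<And>p. p \<in> Z \<Longrightarrow> \<tau> p \<noteq> 0;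
      \<And>F. F \<in> forms d \<Longrightarrow> (\<Sum>p\<in>Z. \<tau> p * evaluate F p) = 0; A' \<subseteq> coords ` A; A' \<subseteq> Z\<rbrakk>
      \<Longrightarrow> 2 * card A' \<le> card Z"
  shows "computes_rank d A T"
proof -
  have A: "finite A" "A \<subseteq> plane" and T: "T \<in> proj_span (veronese d ` A)"
    using comp by (auto simp: computes_def)
  obtain F where F: "F \<noteq> 0" "T = proj_pt F" "F \<in> poly.span (power_form d ` A)"
    using T by (auto simp: proj_span_def projectivization_def span_veronese [OF A(2)])
  obtain c where c: "F = (\<Sum>p\<in>A. scale (c p) (power_form d p))"
    using poly.span_image_coefficients [OF A(1) F(3)] by blast
  \<comment> \<open>A point with zero coefficient could be dropped, against non-redundancy.\<close>
  have c0: "c p \<noteq> 0" if p: "p \<in> A" for p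
  proof
    assume "c p = 0"
    then have "F = (\<Sum>q\<in>A - {p}. scale (c q) (power_form d q))"
      using c A(1) p by (simp add: sum.remove)
    also have "\<dots> \<in> poly.span (power_form d ` (A - {p}))"
      by (intro poly.span_sum poly.span_scale poly.span_base) auto
    finally have "T \<in> proj_span (veronese d ` (A - {p}))"
      using proj_pt_in_proj_span [of "A - {p}" F d] F A by auto
    then show False using nonred p unfolding non_redundant_def by blast
  qed
  have "card A \<le> card B" if "computes d B T" for B
  proof -
    have B: "finite B" "B \<subseteq> plane" and TB: "T \<in> proj_span (veronese d ` B)"
      using that by (auto simp: computes_def)
    then have "F \<in> poly.span (power_form d ` B)"
      using proj_pt_in_proj_span F by blast
    then obtain c' where c': "F = (\<Sum>p\<in>B. scale (c' p) (power_form d p))"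
      using poly.span_image_coefficients [OF B(1)] by blast
    define \<tau> where "\<tau> p = (if p \<in> A then c p else 0) - (if p \<in> B then c' p else 0)" for p
    define Z where "Z = {p \<in> A \<union> B. \<tau> p \<noteq> 0}"
    have finZ: "finite Z" and Zp: "Z \<subseteq> plane" using A B by (auto simp: Z_def)
    have inj: "inj_on coords Z" using Zp by (rule inj_on_coords)
    have "(\<Sum>p\<in>Z. scale (\<tau> p) (power_form d p)) = (\<Sum>p\<in>A \<union> B. scale (\<tau> p) (power_form d p))"
      using A B by (intro sum.mono_neutral_left) (auto simp: Z_def)
    also have "\<dots> = (\<Sum>p\<in>A \<union> B. scale (if p \<in> A then c p else 0) (power_form d p)) -
        (\<Sum>p\<in>A \<union> B. scale (if p \<in> B then c' p else 0) (power_form d p))"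
      by (simp add: \<tau>_def poly.scale_left_diff_distrib sum_subtractf)
    also have "(\<Sum>p\<in>A \<union> B. scale (if p \<in> A then c p else 0) (power_form d p)) = F"
      unfolding c using A B by (intro sum.mono_neutral_cong_right) auto
    also have "(\<Sum>p\<in>A \<union> B. scale (if p \<in> B then c' p else 0) (power_form d p)) = F"
      unfolding c' using A B by (intro sum.mono_neutral_cong_right) auto
    finally have "(\<Sum>p\<in>Z. scale (\<tau> p) (linear_form (coords p) ^ d)) = 0"
      by (simp add: power_form_def)
    then have rel: "(\<Sum>p\<in>Z. \<tau> p * evaluate G (coords p)) = 0" if "G \<in> forms d" for G
      using apolarity [of \<tau> coords d Z] that by blast
    \<comment> \<open>The weights are indexed by points of the plane, while \<open>large\<close>
      speaks of coordinate vectors.\<close>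
    have inv: "the_inv_into Z coords (coords p) = p" if "p \<in> Z" for p
      using inj that by (rule the_inv_into_f_f)
    have "2 * card (coords ` (A \<inter> Z)) \<le> card (coords ` Z)"
    proof (rule large [of _ "\<lambda>a. \<tau> (the_inv_into Z coords a)"])
      show "distinct_points (coords ` Z)" using Zp by (rule distinct_points_coords)
      show "(\<Sum>a\<in>coords ` Z. \<tau> (the_inv_into Z coords a) * evaluate G a) = 0" if "G \<in> forms d" for G
        using rel [OF that] by (simp add: sum.reindex [OF inj] inv cong: sum.cong)
      show "\<tau> (the_inv_into Z coords a) \<noteq> 0" if "a \<in> coords ` Z" for a
        using that inv by (auto simp: Z_def)
    qed (use finZ in auto)
    then have two: "2 * card (A \<inter> Z) \<le> card Z"
      using card_image [OF inj] card_image [OF inj_on_subset [OF inj, of "A \<inter> Z"]] by simp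
    have "Z = (A \<inter> Z) \<union> (B \<inter> Z)" by (auto simp: Z_def)
    then have "card Z \<le> card (A \<inter> Z) + card (B \<inter> Z)" by (metis card_Un_le)
    then have AB: "card (A \<inter> Z) \<le> card (B \<inter> Z)" using two by linarith
    \<comment> \<open>Where \<open>\<tau>\<close> vanishes on \<open>A\<close>, the nonzero
      coefficient \<open>c p\<close> must be cancelled by one from \<open>B\<close>.\<close>
    have "A - Z \<subseteq> B - Z" using c0 by (auto simp: Z_def \<tau>_def)
    then have "card (A - Z) \<le> card (B - Z)" using B(1) by (intro card_mono) auto
    moreover have "card A = card (A \<inter> Z) + card (A - Z)" "card B = card (B \<inter> Z) + card (B - Z)"
      using A(1) B(1) by (metis card_Diff_subset_Int card_Int_Diff finite_Int)+
    ultimately show ?thesis using AB by linarith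
  qed
  then have "form_rank d T = card A"
    unfolding form_rank_def using comp by (intro Least_equality) auto
  then show ?thesis using comp nonred by (simp add: computes_rank_def)
qed

theorem theorem3p6:
  fixes d m r :: nat and T :: "ternary set" and A :: "ternary set set"
  assumes "T \<in> projectivization (forms d)"
    and "computes d A T"
    and "non_redundant d A T"
    and "r = card A"
  shows "(d = 2 * m \<and> hilbert A m = r \<longrightarrow>
            computes_rank d A T \<and> r \<le> (m + 2) choose 2) \<and>
         (d = 2 * m + 1 \<and>
          kruskal_rank m A = min ((m + 2) choose 2) r \<and>
          hilbert A (m + 1) = r \<and>
          r \<le> ((m + 2) choose 2) + nat \<lceil>real m / 2\<rceil> \<longrightarrow>
            computes_rank d A T)"
proof (intro conjI impI; elim conjE)
  have A: "finite A" "A \<subseteq> plane" using assms(2) by (auto simp: computes_def)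
  have inj: "inj_on coords A" using A(2) by (rule inj_on_coords)
  {
    assume d: "d = 2 * m" and h: "hilbert A m = r"
    have int: "interpolating m (coords ` A)"
      using hilbert_interpolating A inj h assms(4) by blast
    have "hilbert_fun m (coords ` A) = r"
      using interpolating_hilbert_fun [OF _ int] A assms(4) card_image [OF inj] by simp
    then show "r \<le> (m + 2) choose 2"
      using hilbert_fun_add_dim [of m "coords ` A"] by linarith
    show "computes_rank d A T"
    proof (rule computes_rank_if_relations_large [OF assms(2,3)])
      fix Z A' \<tau>
      assume Z: "finite Z" "\<And>p. p \<in> Z \<Longrightarrow> \<tau> p \<noteq> 0"
        "\<And>F. F \<in> forms d \<Longrightarrow> (\<Sum>p\<in>Z. \<tau> p * evaluate F p) = 0" and A': "A' \<subseteq> coords ` A" "A' \<subseteq> Z"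
      \<comment> \<open>In even degree the relation splits as \<open>m + m\<close>, and each summand
        is at least \<open>card A'\<close>.\<close>
      have "hilbert_fun m Z + hilbert_fun m Z \<le> card Z"
        using Z(3) by (intro relation_hilbert_fun [of Z \<tau>, OF Z(1,2)]) (simp_all add: d mult_2)
      moreover have "card A' \<le> hilbert_fun m Z"
        using interpolating_hilbert_fun [OF finite_subset [OF A'(2) Z(1)] interpolating_subset [OF int A'(1)]]
          hilbert_fun_mono [OF A'(2), of m] by simp
      ultimately show "2 * card A' \<le> card Z" by linarith
    qed
  }
  {
    assume d: "d = 2 * m + 1" and k: "kruskal_rank m A = min ((m + 2) choose 2) r"
      and h: "hilbert A (m + 1) = r" and r: "r \<le> ((m + 2) choose 2) + nat \<lceil>real m / 2\<rceil>"
    have "nat \<lceil>real m / 2\<rceil> = (m + 1) div 2"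
      by (cases "even m") (auto elim!: evenE oddE intro!: ceiling_unique simp: nat_eq_iff)
    then have r': "r \<le> ((m + 2) choose 2) + (m + 1) div 2" using r by simp
    have int: "interpolating (m + 1) (coords ` A)"
      using hilbert_interpolating A inj h assms(4) by blast
    show "computes_rank d A T"
    proof (rule computes_rank_if_relations_large [OF assms(2,3)])
      fix Z A' \<tau>
      assume Z: "finite Z" "distinct_points Z" "\<And>p. p \<in> Z \<Longrightarrow> \<tau> p \<noteq> 0"
        "\<And>F. F \<in> forms d \<Longrightarrow> (\<Sum>p\<in>Z. \<tau> p * evaluate F p) = 0" and A': "A' \<subseteq> coords ` A" "A' \<subseteq> Z"
      have "card A' \<le> r"
        using card_mono [OF _ A'(1)] A(1) card_image [OF inj] assms(4) by simp
      \<comment> \<open>\<open>J\<close> comes from a subset of \<open>A\<close> with at most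
        \<open>min ((m + 2) choose 2) r\<close> points, which is within the Kruskal rank.\<close>
      moreover have "interpolating m J" if J: "J \<subseteq> A'" "card J \<le> (m + 2) choose 2" for J
      proof -
        obtain J' where J': "J' \<subseteq> A" "J = coords ` J'"
          using J(1) A'(1) by (meson order_trans subset_imageE)
        then have "card J' = card J"
          using card_image [OF inj_on_subset [OF inj]] by simp
        moreover have "card J' \<le> r" using J'(1) A(1) assms(4) by (simp add: card_mono)
        ultimately show ?thesis
          using kruskal_rank_interpolating [OF A(2,1) J'(1), of m] k J(2) J'(2) by simp
      qed
      ultimately show "2 * card A' \<le> card Z"
        using r' Z(4) interpolating_subset [OF int A'(1)]
        by (intro odd_degree_relation [of Z \<tau> m A', OF Z(1,2,3)] A'(2)) (auto simp: d)
    qed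
  }
qed

end
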